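(* Suppose there exist $\beta=(\beta_x,\beta_y)\in(0,+\infty]^2$, $\eta>0$ and a region $\mathcal R\subseteq\mathcal Z$ such that for all $z^*\in\mathcal Z^*$ and all $z\in\mathcal R$, $$G_\beta(z;z^* )\ \ge\ \frac{\eta}{2}\,\mathrm{dist}_V(z,\mathcal Z^* )^2 .$$ Let $(z_k)$ be the PDHG iterates started at $z_0\in\mathcal Z$. If $\mathcal R$ contains $\{z\in\mathcal Z:\ \|z-P_{\mathcal Z^*}(z_0)\|_V\le \mathrm{dist}_V(z_0,\mathcal Z^* )\}$, then for all $k\in\mathbb N$ $$\Big(1+\Lambda\,\frac{\eta}{1+\eta/\lambda}\Big)\,\mathrm{dist}_V(z_{k+1},\mathcal Z^* )^2\ \le\ \mathrm{dist}_V(z_k,\mathcal Z^* )^2,\qquad \Lambda=\frac{\lambda}{\max\big((1+a_2)\lambda+1/\beta_x,\ (2+a_2)\lambda+1/\beta_y\big)} .$$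
   Context: Setting. $\mathcal X,\mathcal Y$ are real Hilbert spaces, $\mathcal Z=\mathcal X\times\mathcal Y$, $z=(x,y)$. $f,f_2:\mathcal X\to\mathbb R\cup\{+\infty\}$ and $g,g_2:\mathcal Y\to\mathbb R\cup\{+\infty\}$ are proper lower semicontinuous convex functions, $A:\mathcal X\to\mathcal Y$ is bounded linear, $f_2$ is differentiable with $L_f$-Lipschitz gradient and the conjugate $g_2^*$ is differentiable with $L_{g^*}$-Lipschitz gradient. The Lagrangian is $L(x,y)=f(x)+f_2(x)+\langle Ax,y\rangle-g^*(y)-g_2^*(y)$; its set of saddle points $\mathcal Z^*$ is assumed nonempty. Norm. For $\tau,\sigma>0$, $\|z\|_V=(\frac1\tau\|x\|^2+\frac1\sigma\|y\|^2)^{1/2}$; $\mathrm{dist}_V$ is the distance in this norm and $P_{\mathcal Z^*}$ the projection onto $\mathcal Z^*$ in this norm. PDHG: $\bar x_{k+1}=\mathrm{prox}_{\tau f}(x_k-\tau\nabla f_2(x_k)-\tau A^\top y_k)$, $\bar y_{k+1}=\mathrm{prox}_{\sigma g^*}(y_k-\sigma\nabla g_2^*(y_k)+\sigma A\bar x_{k+1})$, $x_{k+1}=\bar x_{k+1}-\tau A^\top(\bar y_{k+1}-y_k)$, $y_{k+1}=\bar y_{k+1}$, where $\mathrm{prox}_h(u)=\arg\min_{u'}h(u')+\frac12\|u-u'\|^2$. Constants. $\gamma=\sigma\tau\|A\|^2$, $\alpha_f=\tau L_f/2$, $\alpha_g=\sigma L_{g^*}/2$; the step sizes satisfy $\gamma<1$,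 $\alpha_f<1$, $\alpha_g+\gamma<1$. $$\lambda=1-\alpha_f-\tfrac{\alpha_g-(1-\gamma)\alpha_f}{2}-\sqrt{(1-\alpha_f)^2\gamma+\tfrac{((1-\gamma)\alpha_f-\alpha_g)^2}{4}},\qquad a_2=\max\Big(\tfrac{2\alpha_f-1}{1-\alpha_f},\tfrac{2\alpha_g-1+\gamma}{1-\alpha_g-\gamma}\Big)\ge-1 .$$ Smoothed gap. For $\beta=(\beta_x,\beta_y)\in[0,+\infty]^2$ and $z,\dot z\in\mathcal Z$, $$G_\beta(z;\dot z)=\sup_{z'=(x',y')\in\mathcal Z}L(x,y')-L(x',y)-\frac{\beta_x}{2\tau}\|x'-\dot x\|^2-\frac{\beta_y}{2\sigma}\|y'-\dot y\|^2,$$ where an infinite $\beta_x$ (resp. $\beta_y$) forces $x'=\dot x$ (resp. $y'=\dot y$), and $1/\infty=0$. *)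

theory Defs
  imports "HOL-Analysis.Analysis"
begin

text \<open>
  Real Hilbert spaces are types of sort \<open>{real_inner, complete_space}\<close>. Functions with values in
  the reals extended by plus infinity are functions into \<^typ>\<open>ereal\<close> that avoid minus infinity.
\<close>

definition proper_fun :: "('a \<Rightarrow> ereal) \<Rightarrow> bool" where
  "proper_fun h \<longleftrightarrow> (\<forall>x. h x \<noteq> -\<infinity>) \<and> (\<exists>x. h x \<noteq> \<infinity>)"

definition lsc_fun :: "('a::topological_space \<Rightarrow> ereal) \<Rightarrow> bool" where
  "lsc_fun h \<longleftrightarrow> (\<forall>x. h x \<le> Liminf (at x) h)"

(* The end points u = 0, 1 are harmless because 0 * \<infinity> = 0 in ereal. *)
definition convex_fun :: "('a::real_vector \<Rightarrow> ereal) \<Rightarrow> bool" where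
  "convex_fun h \<longleftrightarrow>
    (\<forall>x y u. 0 \<le> u \<and> u \<le> 1 \<longrightarrow>
       h ((1 - u) *\<^sub>R x + u *\<^sub>R y) \<le> ereal (1 - u) * h x + ereal u * h y)"

definition proper_lsc_convex :: "('a::real_normed_vector \<Rightarrow> ereal) \<Rightarrow> bool" where
  "proper_lsc_convex h \<longleftrightarrow> proper_fun h \<and> lsc_fun h \<and> convex_fun h"

definition conjugate :: "('a::real_inner \<Rightarrow> ereal) \<Rightarrow> 'a \<Rightarrow> ereal" where
  "conjugate h y = (SUP u. ereal (u \<bullet> y) - h u)"

(* real_of_ereal sends infinite values to 0, so finiteness near x is required explicitly. *)
definition has_gradient :: "('a::real_inner \<Rightarrow> ereal) \<Rightarrow> 'a \<Rightarrow> 'a \<Rightarrow> bool" where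
  "has_gradient h x D \<longleftrightarrow>
    (\<forall>\<^sub>F u in nhds x. \<bar>h u\<bar> \<noteq> \<infinity>) \<and> GDERIV (\<lambda>u. real_of_ereal (h u)) x :> D"

definition gradient :: "('a::real_inner \<Rightarrow> ereal) \<Rightarrow> 'a \<Rightarrow> 'a" where
  "gradient h x = (THE D. has_gradient h x D)"

definition lipschitz_smooth :: "real \<Rightarrow> ('a::real_inner \<Rightarrow> ereal) \<Rightarrow> bool" where
  "lipschitz_smooth L h \<longleftrightarrow>
    (\<forall>x. \<exists>D. has_gradient h x D) \<and> L-lipschitz_on UNIV (gradient h)"

definition prox :: "('a::real_inner \<Rightarrow> ereal) \<Rightarrow> 'a \<Rightarrow> 'a" where
  "prox h u = arg_min (\<lambda>v. h v + ereal ((norm (u - v))\<^sup>2 / 2)) (\<lambda>_. True)"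

text \<open>
  If f x and the conjugate of g at y are both infinite, the difference below is of the form
  \<open>\<infinity> - \<infinity>\<close>, which is \<open>\<infinity>\<close> in \<^typ>\<open>ereal\<close>. This choice is immaterial for the saddle points
  (they lie in the domain whenever f and the conjugate of g are proper), and at a saddle point
  \<open>\<zeta>\<close> it makes \<open>smoothed_gap\<close> below equal to \<open>\<infinity>\<close> for z outside the domain.
\<close>

definition lagrangian ::
    "('a::real_inner \<Rightarrow> 'b::real_inner) \<Rightarrow> ('a \<Rightarrow> ereal) \<Rightarrow> ('a \<Rightarrow> ereal) \<Rightarrow> ('b \<Rightarrow> ereal) \<Rightarrow>
     ('b \<Rightarrow> ereal) \<Rightarrow> 'a \<Rightarrow> 'b \<Rightarrow> ereal" where
  "lagrangian A f f2 g g2 x y =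
     f x + f2 x + ereal (A x \<bullet> y) - conjugate g y - conjugate g2 y"

definition saddle_points :: "('a \<Rightarrow> 'b \<Rightarrow> ereal) \<Rightarrow> ('a \<times> 'b) set" where
  "saddle_points L = {(x, y). \<forall>x' y'. L x y' \<le> L x y \<and> L x y \<le> L x' y}"

definition norm_V ::
    "real \<Rightarrow> real \<Rightarrow> 'a::real_normed_vector \<times> 'b::real_normed_vector \<Rightarrow> real" where
  "norm_V \<tau> \<sigma> z = sqrt (1 / \<tau> * (norm (fst z))\<^sup>2 + 1 / \<sigma> * (norm (snd z))\<^sup>2)"

definition dist_V ::
    "real \<Rightarrow> real \<Rightarrow> 'a::real_normed_vector \<times> 'b::real_normed_vector \<Rightarrow> ('a \<times> 'b) set \<Rightarrow> real" where
  "dist_V \<tau> \<sigma> z S = (INF w\<in>S. norm_V \<tau> \<sigma> (z - w))"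

definition proj_V ::
    "real \<Rightarrow> real \<Rightarrow> ('a::real_normed_vector \<times> 'b::real_normed_vector) set \<Rightarrow> 'a \<times> 'b \<Rightarrow> 'a \<times> 'b" where
  "proj_V \<tau> \<sigma> S z = arg_min_on (\<lambda>w. norm_V \<tau> \<sigma> (z - w)) S"

definition pdhg_step ::
    "('a::real_inner \<Rightarrow> 'b::real_inner) \<Rightarrow> ('a \<Rightarrow> ereal) \<Rightarrow> ('a \<Rightarrow> ereal) \<Rightarrow> ('b \<Rightarrow> ereal) \<Rightarrow>
     ('b \<Rightarrow> ereal) \<Rightarrow> real \<Rightarrow> real \<Rightarrow> 'a \<times> 'b \<Rightarrow> 'a \<times> 'b" where
  "pdhg_step A f f2 g g2 \<tau> \<sigma> z =
     (let x = fst z; y = snd z;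
          x_bar = prox (\<lambda>u. ereal \<tau> * f u)
                    (x - \<tau> *\<^sub>R gradient f2 x - \<tau> *\<^sub>R adjoint A y);
          y_bar = prox (\<lambda>v. ereal \<sigma> * conjugate g v)
                    (y - \<sigma> *\<^sub>R gradient (conjugate g2) y + \<sigma> *\<^sub>R A x_bar)
      in (x_bar - \<tau> *\<^sub>R adjoint A (y_bar - y), y_bar))"

definition pdhg ::
    "('a::real_inner \<Rightarrow> 'b::real_inner) \<Rightarrow> ('a \<Rightarrow> ereal) \<Rightarrow> ('a \<Rightarrow> ereal) \<Rightarrow> ('b \<Rightarrow> ereal) \<Rightarrow>
     ('b \<Rightarrow> ereal) \<Rightarrow> real \<Rightarrow> real \<Rightarrow> 'a \<times> 'b \<Rightarrow> nat \<Rightarrow> 'a \<times> 'b" where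
  "pdhg A f f2 g g2 \<tau> \<sigma> z0 k = (pdhg_step A f f2 g g2 \<tau> \<sigma> ^^ k) z0"

(* An infinite parameter is handled by restricting the supremum; the corresponding penalty is
   then \<infinity> * 0 = 0. *)
definition smoothed_gap ::
    "('a::real_inner \<Rightarrow> 'b::real_inner \<Rightarrow> ereal) \<Rightarrow> real \<Rightarrow> real \<Rightarrow> ereal \<Rightarrow> ereal \<Rightarrow>
     'a \<times> 'b \<Rightarrow> 'a \<times> 'b \<Rightarrow> ereal" where
  "smoothed_gap L \<tau> \<sigma> \<beta>x \<beta>y z \<zeta> =
     (SUP (x', y') \<in> {(x', y'). (\<beta>x = \<infinity> \<longrightarrow> x' = fst \<zeta>) \<and> (\<beta>y = \<infinity> \<longrightarrow> y' = snd \<zeta>)}.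
        L (fst z) y' - L x' (snd z)
        - \<beta>x * ereal ((norm (x' - fst \<zeta>))\<^sup>2 / (2 * \<tau>))
        - \<beta>y * ereal ((norm (y' - snd \<zeta>))\<^sup>2 / (2 * \<sigma>)))"

end

theory Submission
  imports Defs
begin

text \<open>
  For \<open>z = z\<^sub>k\<close> with successor \<open>z\<^sup>+\<close> and intermediate point \<open>zb = (xb, yb)\<close>, the proximal and
  smoothness inequalities bound the primal-dual gap of \<open>zb\<close> against every \<open>z'\<close> by
  \<open>(|z - z'|\<^sup>2 - |z\<^sup>+ - z'|\<^sup>2 + a2 W) / 2\<close>, while cocoercivity of the gradients gives
  \<open>|z\<^sup>+ - s|\<^sup>2 + W \<le> |z - s|\<^sup>2\<close> for saddle points \<open>s\<close>, where \<open>W \<ge> lam |z\<^sup>+ - z|\<^sup>2\<close>. Taking the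
  supremum over \<open>z'\<close> with the penalty centred at the projection of \<open>z\<close> onto the saddle points
  bounds the smoothed gap by the decrease of the squared distance, up to the factor in \<open>\<Lambda>\<close>.

  The growth condition cannot be applied to \<open>zb\<close>, which may leave the region R. It is applied instead
  to the projection \<open>w\<close> of \<open>zb\<close> onto the ball around the saddle point \<open>c = P(z\<^sub>0)\<close>. As \<open>w\<close> lies on the
  segment from \<open>c\<close> to \<open>zb\<close>, convexity transfers the gap bound from \<open>zb\<close> to \<open>w\<close>; as \<open>z\<^sup>+\<close> stays in the
  ball, \<open>|w - z\<^sup>+| \<le> |zb - z\<^sup>+|\<close>, so passing from \<open>dist(w)\<close> to \<open>dist(z\<^sup>+)\<close> costs no more than it would for \<open>zb\<close>.
\<close>

subsection \<open>Proper lower semicontinuous convex functions\<close>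

text \<open>Removes the first-order error after a comparison along a segment has been divided by its
  step length \<open>s\<close>.\<close>

lemma le_of_le_add_small:
  fixes a b c :: real
  assumes "\<And>s. 0 < s \<Longrightarrow> s \<le> 1 \<Longrightarrow> a \<le> b + s * c"
  shows "a \<le> b"
proof (rule field_le_epsilon)
  fix e :: real assume e: "e > 0"
  define s where "s = min 1 (e / (\<bar>c\<bar> + 1))"
  have s: "0 < s" "s \<le> 1" using e by (auto simp: s_def)
  have "s * c \<le> s * (\<bar>c\<bar> + 1)" using s by (intro mult_left_mono) auto
  also have "\<dots> \<le> e / (\<bar>c\<bar> + 1) * (\<bar>c\<bar> + 1)"
    by (intro mult_right_mono) (simp_all add: s_def)
  also have "\<dots> = e" using abs_ge_zero[of c] by (simp add: nonzero_divide_eq_eq)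
  finally show "a \<le> b + e" using assms[OF s] by linarith
qed

lemma lsc_fun_iff_eventually:
  "lsc_fun h \<longleftrightarrow> (\<forall>x c. c < h x \<longrightarrow> (\<forall>\<^sub>F u in nhds x. c < h u))"
  by (auto simp: lsc_fun_def le_Liminf_iff eventually_nhds_conv_at)

lemma proper_fun_ereal:
  assumes "proper_fun h" "h x \<noteq> \<infinity>"
  shows "h x = ereal (real_of_ereal (h x))"
  using assms by (cases "h x") (auto simp: proper_fun_def)

lemma convex_fun_real:
  assumes "proper_fun h" "convex_fun h" "h x \<noteq> \<infinity>" "h y \<noteq> \<infinity>" "0 \<le> s" "s \<le> 1"
  shows convex_fun_finite: "h ((1 - s) *\<^sub>R x + s *\<^sub>R y) \<noteq> \<infinity>"
    and convex_fun_real_le: "real_of_ereal (h ((1 - s) *\<^sub>R x + s *\<^sub>R y))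
       \<le> (1 - s) * real_of_ereal (h x) + s * real_of_ereal (h y)"
proof -
  have le: "h ((1 - s) *\<^sub>R x + s *\<^sub>R y) \<le> ereal (1 - s) * h x + ereal s * h y"
    using assms by (auto simp: convex_fun_def)
  obtain a b where ab: "h x = ereal a" "h y = ereal b"
    using assms(1,3,4) by (cases "h x"; cases "h y") (auto simp: proper_fun_def)
  show fin: "h ((1 - s) *\<^sub>R x + s *\<^sub>R y) \<noteq> \<infinity>" using le ab by auto
  then obtain c where "h ((1 - s) *\<^sub>R x + s *\<^sub>R y) = ereal c"
    using proper_fun_ereal[OF assms(1)] by fast
  then show "real_of_ereal (h ((1 - s) *\<^sub>R x + s *\<^sub>R y))
       \<le> (1 - s) * real_of_ereal (h x) + s * real_of_ereal (h y)"
    using le ab by simp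
qed

lemma norm_sq_convex_combination:
  fixes x y u :: "'a::real_inner"
  shows "(norm (u - ((1 - s) *\<^sub>R x + s *\<^sub>R y)))\<^sup>2
    = (1 - s) * (norm (u - x))\<^sup>2 + s * (norm (u - y))\<^sup>2 - s * (1 - s) * (norm (x - y))\<^sup>2"
  unfolding power2_norm_eq_inner
  by (simp add: inner_simps inner_commute[of y x] inner_commute[of x u] inner_commute[of y u])
    (simp add: algebra_simps)

lemma norm_sq_midpoint:
  fixes x y u :: "'a::real_inner"
  shows "(norm (u - ((1/2) *\<^sub>R x + (1/2) *\<^sub>R y)))\<^sup>2
    = ((norm (u - x))\<^sup>2 + (norm (u - y))\<^sup>2) / 2 - (norm (x - y))\<^sup>2 / 4"
  using norm_sq_convex_combination[of u "1/2" x y] by simp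

text \<open>Lower semicontinuity keeps \<open>h\<close> above \<open>h x0 - 1\<close> on a small
  ball; convexity along rays from \<open>x0\<close> then allows at most linear decrease outside it.
  This weak bound starts the existence proof for proximal points.\<close>

lemma proper_lsc_convex_linear_minorant:
  fixes h :: "'a::real_normed_vector \<Rightarrow> ereal"
  assumes "proper_lsc_convex h" "h x0 \<noteq> \<infinity>"
  shows "\<exists>K. \<forall>v. h v \<noteq> \<infinity> \<longrightarrow>
    real_of_ereal (h x0) - 1 - K * norm (v - x0) \<le> real_of_ereal (h v)"
proof -
  have pr: "proper_fun h" and lsc: "lsc_fun h" and cv: "convex_fun h"
    using assms by (auto simp: proper_lsc_convex_def)
  define k where "k v = real_of_ereal (h v)" for v
  have k: "h v = ereal (k v)" if "h v \<noteq> \<infinity>" for v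
    using proper_fun_ereal[OF pr that] by (simp add: k_def)
  have "ereal (k x0 - 1) < h x0" by (subst k[OF assms(2)]) simp
  then have "\<forall>\<^sub>F v in nhds x0. ereal (k x0 - 1) < h v"
    using lsc by (auto simp: lsc_fun_iff_eventually)
  then obtain r where r: "r > 0" "\<And>v. dist v x0 < r \<Longrightarrow> ereal (k x0 - 1) < h v"
    by (auto simp: eventually_nhds_metric)
  define \<rho> where "\<rho> = r / 2"
  have \<rho>: "\<rho> > 0" "\<rho> < r" using r by (auto simp: \<rho>_def)
  have near: "k x0 - 1 < k v" if "h v \<noteq> \<infinity>" "dist v x0 < r" for v
    using r(2)[OF that(2)] k[OF that(1)] by simp
  have "k x0 - 1 - norm (v - x0) / \<rho> \<le> k v" if v: "h v \<noteq> \<infinity>" for v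
  proof (cases "norm (v - x0) < \<rho>")
    case True
    moreover have "0 \<le> norm (v - x0) / \<rho>" using \<rho> by simp
    moreover have "k x0 - 1 < k v" using near[OF v] True \<rho> by (auto simp: dist_norm)
    ultimately show ?thesis by linarith
  next
    case False
    \<comment> \<open>The weight \<open>s\<close> puts \<open>p\<close> on the sphere of radius
      \<open>\<rho>\<close> around \<open>x0\<close>, where the local bound holds; solving the
      convexity inequality for \<open>k v\<close> gives the slope \<open>1 / \<rho>\<close>.\<close>
    define d s where "d = norm (v - x0)" and "s = \<rho> / d"
    have d: "d \<ge> \<rho>" "d > 0" using False \<rho> by (auto simp: d_def)
    have s: "0 < s" "s \<le> 1" using d \<rho> by (auto simp: s_def)
    define p where "p = (1 - s) *\<^sub>R x0 + s *\<^sub>R v"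
    have pfin: "h p \<noteq> \<infinity>" and pk: "k p \<le> (1 - s) * k x0 + s * k v"
      unfolding p_def k_def using convex_fun_real[OF pr cv assms(2) v] s by auto
    have "p - x0 = s *\<^sub>R (v - x0)" by (simp add: p_def algebra_simps)
    then have "dist p x0 = \<rho>" using s d \<rho> by (simp add: dist_norm d_def[symmetric] s_def)
    then have "k x0 - 1 < k p" using near[OF pfin] \<rho> by simp
    with pk have "- 1 \<le> s * (k v - k x0)" by (simp add: algebra_simps)
    then have "- 1 / s \<le> k v - k x0" using s by (simp add: field_simps)
    moreover have "- 1 / s = - norm (v - x0) / \<rho>" by (simp add: s_def d_def)
    ultimately show ?thesis by simp
  qed
  then show ?thesis unfolding k_def by (intro exI[of _ "1 / \<rho>"]) simp
qed

text \<open>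
  A minimising sequence of a strongly convex function is Cauchy; this is the only place where
  completeness enters. Riesz representation, metric projection and the affine minorants behind
  \<open>proper_lsc_convex_conjugate\<close> are all obtained from proximal points.
\<close>

theorem prox_exists:
  fixes h :: "'a::{real_inner, complete_space} \<Rightarrow> ereal"
  assumes "proper_lsc_convex h"
  shows "\<exists>p. h p \<noteq> \<infinity> \<and> (\<forall>v. h p + ereal ((norm (u - p))\<^sup>2 / 2) \<le> h v + ereal ((norm (u - v))\<^sup>2 / 2))"
proof -
  have pr: "proper_fun h" and lsc: "lsc_fun h" and cv: "convex_fun h"
    using assms by (auto simp: proper_lsc_convex_def)
  define k where "k v = real_of_ereal (h v)" for v
  have k: "h v = ereal (k v)" if "h v \<noteq> \<infinity>" for v
    using proper_fun_ereal[OF pr that] by (simp add: k_def)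
  define D where "D = {v. h v \<noteq> \<infinity>}"
  define F where "F v = k v + (norm (u - v))\<^sup>2 / 2" for v
  obtain x0 where x0: "h x0 \<noteq> \<infinity>" using pr by (auto simp: proper_fun_def)
  obtain K where K: "\<And>v. h v \<noteq> \<infinity> \<Longrightarrow> k x0 - 1 - K * norm (v - x0) \<le> k v"
    using proper_lsc_convex_linear_minorant[OF assms x0] by (auto simp: k_def)
  \<comment> \<open>The quadratic term absorbs the linear minorant: completing the square costs only
    the constant \<open>\<bar>K\<bar>\<^sup>2 / 2\<close>.\<close>
  have lower: "k x0 - 1 - \<bar>K\<bar> * norm (u - x0) - \<bar>K\<bar>\<^sup>2 / 2 \<le> F v" if "v \<in> D" for v
  proof -
    have "norm (v - x0) \<le> norm (u - x0) + norm (u - v)"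
      using norm_triangle_ineq4[of "u - x0" "u - v"] by simp
    then have "\<bar>K\<bar> * norm (v - x0) \<le> \<bar>K\<bar> * norm (u - x0) + \<bar>K\<bar> * norm (u - v)"
      unfolding distrib_left[symmetric] by (rule mult_left_mono) simp
    moreover have "K * norm (v - x0) \<le> \<bar>K\<bar> * norm (v - x0)" by (intro mult_right_mono) auto
    moreover have "0 \<le> (norm (u - v) - \<bar>K\<bar>)\<^sup>2" by simp
    then have "0 \<le> (norm (u - v))\<^sup>2 - 2 * (\<bar>K\<bar> * norm (u - v)) + \<bar>K\<bar>\<^sup>2"
      unfolding power2_diff by (simp add: algebra_simps)
    moreover have "k x0 - 1 - K * norm (v - x0) \<le> k v" using K that by (simp add: D_def)
    ultimately show ?thesis unfolding F_def by linarith
  qed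
  define m where "m = (INF v\<in>D. F v)"
  have bdd: "bdd_below (F ` D)" using lower by (auto simp: bdd_below_def)
  have ne: "D \<noteq> {}" using x0 by (auto simp: D_def)
  have m_le: "m \<le> F v" if "v \<in> D" for v
    unfolding m_def using bdd that by (rule cINF_lower)
  have "\<exists>v\<in>D. F v < m + 1 / Suc n" for n
    using cINF_less_iff[OF ne bdd, of "m + 1 / Suc n"] by (simp add: m_def)
  then obtain V where V: "\<And>n. V n \<in> D" "\<And>n. F (V n) < m + 1 / Suc n" by metis
  \<comment> \<open>Strong convexity at the midpoint, whose value is at least \<open>m\<close>,
    turns near-minimality into closeness.\<close>
  have close: "(norm (a - b))\<^sup>2 \<le> 4 * (F a - m) + 4 * (F b - m)" if "a \<in> D" "b \<in> D" for a b
  proof -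
    let ?c = "(1/2) *\<^sub>R a + (1/2) *\<^sub>R b"
    have c: "?c \<in> D" "k ?c \<le> (k a + k b) / 2"
      using convex_fun_real[OF pr cv, of a b "1/2"] that by (auto simp: D_def k_def)
    have "m \<le> F ?c" using m_le c(1) by blast
    also have "\<dots> \<le> (F a + F b) / 2 - (norm (a - b))\<^sup>2 / 8"
      unfolding F_def norm_sq_midpoint using c(2) by (simp add: field_simps)
    finally show ?thesis by (simp add: field_simps)
  qed
  have "Cauchy V"
  proof (rule metric_CauchyI)
    fix e :: real assume e: "e > 0"
    obtain N where N: "inverse (real (Suc N)) < e\<^sup>2 / 8" using reals_Archimedean[of "e\<^sup>2/8"] e by auto
    have small: "F (V n) - m < e\<^sup>2 / 8" if "n \<ge> N" for n
    proof -
      have "1 / real (Suc n) \<le> 1 / real (Suc N)" using that by (simp add: field_simps)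
      then show ?thesis using V(2)[of n] N by (simp add: inverse_eq_divide)
    qed
    have "dist (V i) (V j) < e" if "i \<ge> N" "j \<ge> N" for i j
    proof -
      have "(norm (V i - V j))\<^sup>2 < e\<^sup>2"
        using close[OF V(1)[of i] V(1)[of j]] small[OF that(1)] small[OF that(2)] by argo
      then show ?thesis using e by (simp add: dist_norm power2_less_imp_less[of _ e])
    qed
    then show "\<exists>M. \<forall>i\<ge>M. \<forall>j\<ge>M. dist (V i) (V j) < e" by blast
  qed
  then obtain p where p: "V \<longlonglongrightarrow> p" by (auto simp: Cauchy_convergent_iff convergent_def)
  \<comment> \<open>Reals below \<open>h p\<close> are compared with the values along
    \<open>V\<close>, so finiteness of \<open>h p\<close> comes out as a conclusion.\<close>
  have hp: "h p \<le> ereal (m - (norm (u - p))\<^sup>2 / 2)"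
  proof (rule dense_le)
    fix c assume c: "c < h p"
    show "c \<le> ereal (m - (norm (u - p))\<^sup>2 / 2)"
    proof (cases c)
      case (real r)
      have "\<forall>\<^sub>F n in sequentially. c < h (V n)"
        using lsc c p by (auto simp: lsc_fun_iff_eventually filterlim_iff)
      then have "\<forall>\<^sub>F n in sequentially. r \<le> m + 1 / Suc n - (norm (u - V n))\<^sup>2 / 2"
      proof eventually_elim
        case (elim n)
        then have "r < k (V n)" using k[of "V n"] V(1)[of n] real by (auto simp: D_def)
        then show ?case using V(2)[of n] by (simp add: F_def)
      qed
      moreover have "(\<lambda>n. m + 1 / Suc n - (norm (u - V n))\<^sup>2 / 2) \<longlonglongrightarrow> m + 0 - (norm (u - p))\<^sup>2 / 2"
        by (intro tendsto_intros p LIMSEQ_Suc[OF lim_1_over_n]) simp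
      ultimately have "r \<le> m + 0 - (norm (u - p))\<^sup>2 / 2"
        by (intro tendsto_lowerbound[OF _ _ sequentially_bot])
      then show ?thesis using real by simp
    qed (use c in auto)
  qed
  then have fin: "h p \<noteq> \<infinity>" by auto
  have "h p + ereal ((norm (u - p))\<^sup>2 / 2) \<le> h v + ereal ((norm (u - v))\<^sup>2 / 2)" for v
  proof (cases "h v = \<infinity>")
    case False
    have "F p \<le> m" using hp k[OF fin] by (simp add: F_def)
    also have "m \<le> F v" using m_le False by (simp add: D_def)
    finally show ?thesis using k[OF fin] k[OF False] by (simp add: F_def)
  qed auto
  with fin show ?thesis by blast
qed

text \<open>\<open>arg_min\<close> is a Hilbert choice, so its defining property is available only
  once some minimiser exists.\<close>

lemma prox_minimizes:
  fixes h :: "'a::{real_inner, complete_space} \<Rightarrow> ereal"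
  assumes "proper_lsc_convex h"
  shows "h (prox h u) + ereal ((norm (u - prox h u))\<^sup>2 / 2) \<le> h v + ereal ((norm (u - v))\<^sup>2 / 2)"
proof -
  obtain p where "\<forall>v. h p + ereal ((norm (u - p))\<^sup>2 / 2) \<le> h v + ereal ((norm (u - v))\<^sup>2 / 2)"
    using prox_exists[OF assms] by blast
  then have "is_arg_min (\<lambda>v. h v + ereal ((norm (u - v))\<^sup>2 / 2)) (\<lambda>_. True) p"
    by (auto simp: is_arg_min_linorder)
  then have "is_arg_min (\<lambda>v. h v + ereal ((norm (u - v))\<^sup>2 / 2)) (\<lambda>_. True) (prox h u)"
    unfolding prox_def arg_min_def by (rule someI)
  then show ?thesis by (auto simp: is_arg_min_linorder)
qed

lemma prox_finite:
  fixes h :: "'a::{real_inner, complete_space} \<Rightarrow> ereal"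
  assumes "proper_lsc_convex h"
  shows "h (prox h u) \<noteq> \<infinity>"
proof -
  obtain p where "h p \<noteq> \<infinity>" using assms by (auto simp: proper_lsc_convex_def proper_fun_def)
  then show ?thesis using prox_minimizes[OF assms, of u p] by auto
qed

text \<open>Minimality against points of the segment from \<open>p\<close> to \<open>v\<close>,
  divided by \<open>s\<close> with \<open>s\<close> tending to 0: \<open>u - prox h u\<close> is a
  subgradient of \<open>h\<close> at the proximal point.\<close>

lemma prox_subgradient:
  fixes h :: "'a::{real_inner, complete_space} \<Rightarrow> ereal"
  assumes plc: "proper_lsc_convex h" and v: "h v \<noteq> \<infinity>"
  shows "real_of_ereal (h (prox h u)) + (u - prox h u) \<bullet> (v - prox h u) \<le> real_of_ereal (h v)"
proof -
  define p where "p = prox h u"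
  have pr: "proper_fun h" and cv: "convex_fun h"
    using plc by (auto simp: proper_lsc_convex_def)
  define k where "k v = real_of_ereal (h v)" for v
  have k: "h v = ereal (k v)" if "h v \<noteq> \<infinity>" for v
    using proper_fun_ereal[OF pr that] by (simp add: k_def)
  have p: "h p \<noteq> \<infinity>" unfolding p_def by (rule prox_finite[OF plc])
  have "k p + (u - p) \<bullet> (v - p) \<le> k v + s * ((norm (v - p))\<^sup>2 / 2)" if s: "0 < s" "s \<le> 1" for s
  proof -
    let ?w = "(1 - s) *\<^sub>R p + s *\<^sub>R v"
    have w: "h ?w \<noteq> \<infinity>" "k ?w \<le> (1 - s) * k p + s * k v"
      unfolding k_def using convex_fun_real[OF pr cv p v] s by auto
    have "u - ?w = (u - p) - s *\<^sub>R (v - p)" by (simp add: algebra_simps)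
    then have "(norm (u - ?w))\<^sup>2
        = (norm (u - p))\<^sup>2 - 2 * s * ((u - p) \<bullet> (v - p)) + s\<^sup>2 * (norm (v - p))\<^sup>2"
      unfolding power2_norm_eq_inner
      by (simp add: power2_eq_square inner_diff_left inner_diff_right inner_commute algebra_simps)
    moreover have "k p + (norm (u - p))\<^sup>2 / 2 \<le> k ?w + (norm (u - ?w))\<^sup>2 / 2"
      using prox_minimizes[OF plc, of u ?w] k[OF p] k[OF w(1)] unfolding p_def by simp
    ultimately have "k p \<le> (1 - s) * k p + s * k v - s * ((u - p) \<bullet> (v - p))
        + s\<^sup>2 * (norm (v - p))\<^sup>2 / 2"
      using w(2) by (simp add: field_simps)
    then have "0 \<le> s * (k v - k p - (u - p) \<bullet> (v - p) + s * ((norm (v - p))\<^sup>2 / 2))"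
      by (simp only: algebra_simps power2_eq_square times_divide_eq_right)
    then show ?thesis using s by (simp add: zero_le_mult_iff)
  qed
  then show ?thesis unfolding k_def p_def by (rule le_of_le_add_small)
qed

text \<open>At interior weights an infinite value makes the right side infinite, and the end points
  follow from \<open>0 * \<infinity> = 0\<close>.\<close>

lemma convex_funI:
  assumes nm: "\<And>x. h x \<noteq> -\<infinity>"
    and le: "\<And>x y s a b. h x = ereal a \<Longrightarrow> h y = ereal b \<Longrightarrow> 0 < s \<Longrightarrow> s < 1 \<Longrightarrow>
      h ((1 - s) *\<^sub>R x + s *\<^sub>R y) \<le> ereal ((1 - s) * a + s * b)"
  shows "convex_fun h"
  unfolding convex_fun_def
proof (intro allI impI)
  fix x y s assume s: "0 \<le> s \<and> s \<le> (1::real)"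
  consider "s = 0" | "s = 1" | "0 < s" "s < 1" using s by linarith
  then show "h ((1 - s) *\<^sub>R x + s *\<^sub>R y) \<le> ereal (1 - s) * h x + ereal s * h y"
  proof cases
    case 3
    show ?thesis
    proof (cases "h x = \<infinity> \<or> h y = \<infinity>")
      case True
      have "ereal (1 - s) * h x + ereal s * h y = \<infinity>"
        using 3 True nm[of x] nm[of y] by (cases "h x"; cases "h y") auto
      then show ?thesis by (simp only: ereal_less_eq)
    next
      case False
      then obtain a b where "h x = ereal a" "h y = ereal b"
        using nm[of x] nm[of y] by (cases "h x"; cases "h y") auto
      then show ?thesis using le[of x a y b s] 3 by simp
    qed
  qed (simp_all add: one_ereal_def[symmetric] zero_ereal_def[symmetric])
qed

lemma proper_lsc_convex_scale:
  assumes "proper_lsc_convex h" "t > 0"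
  shows "proper_lsc_convex (\<lambda>u. ereal t * h u)"
proof -
  have pr: "proper_fun h" and lsc: "lsc_fun h" and cv: "convex_fun h"
    using assms by (auto simp: proper_lsc_convex_def)
  have nm: "ereal t * h u \<noteq> -\<infinity>" for u
    using pr assms(2) by (cases "h u") (auto simp: proper_fun_def)
  moreover obtain u where "h u \<noteq> \<infinity>" using pr by (auto simp: proper_fun_def)
  then have "ereal t * h u \<noteq> \<infinity>" using assms(2) by (cases "h u") auto
  ultimately have "proper_fun (\<lambda>u. ereal t * h u)" by (auto simp: proper_fun_def)
  moreover have "lsc_fun (\<lambda>u. ereal t * h u)"
    using lsc assms(2) by (auto simp: lsc_fun_iff_eventually ereal_divide_less_pos[symmetric])
  moreover have "convex_fun (\<lambda>u. ereal t * h u)"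
  proof (rule convex_funI[OF nm])
    fix x y s a b
    assume *: "ereal t * h x = ereal a" "ereal t * h y = ereal b" "0 < s" "s < (1::real)"
    obtain p q where pq: "h x = ereal p" "h y = ereal q" "a = t * p" "b = t * q"
      using * assms(2) by (cases "h x"; cases "h y") auto
    have "h ((1 - s) *\<^sub>R x + s *\<^sub>R y) \<le> ereal ((1 - s) * p + s * q)"
      using cv pq *(3,4) unfolding convex_fun_def by (metis less_imp_le plus_ereal.simps(1) times_ereal.simps(1))
    then have "ereal t * h ((1 - s) *\<^sub>R x + s *\<^sub>R y) \<le> ereal t * ereal ((1 - s) * p + s * q)"
      using assms(2) by (intro ereal_mult_left_mono) auto
    also have "\<dots> = ereal ((1 - s) * a + s * b)" by (simp add: pq algebra_simps)
    finally show "ereal t * h ((1 - s) *\<^sub>R x + s *\<^sub>R y) \<le> ereal ((1 - s) * a + s * b)" .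
  qed
  ultimately show ?thesis by (simp add: proper_lsc_convex_def)
qed

section \<open>Fenchel conjugates\<close>

lemma conjugate_ge: "ereal (u \<bullet> y) - h u \<le> conjugate h y"
  unfolding conjugate_def by (rule SUP_upper) simp

lemma conjugate_not_MInf:
  assumes "proper_fun h"
  shows "conjugate h y \<noteq> -\<infinity>"
proof -
  obtain u where u: "h u \<noteq> \<infinity>" "h u \<noteq> -\<infinity>" using assms by (auto simp: proper_fun_def)
  then show ?thesis using conjugate_ge[of u y h] by (cases "h u") auto
qed

lemma convex_fun_conjugate:
  assumes "proper_fun h"
  shows "convex_fun (conjugate h)"
proof (rule convex_funI[OF conjugate_not_MInf[OF assms]])
  fix x y s a b
  assume *: "conjugate h x = ereal a" "conjugate h y = ereal b" "0 < s" "s < (1::real)"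
  show "conjugate h ((1 - s) *\<^sub>R x + s *\<^sub>R y) \<le> ereal ((1 - s) * a + s * b)"
    unfolding conjugate_def
  proof (rule SUP_least)
    fix u
    show "ereal (u \<bullet> ((1 - s) *\<^sub>R x + s *\<^sub>R y)) - h u \<le> ereal ((1 - s) * a + s * b)"
    proof (cases "h u")
      case (real r)
      have "u \<bullet> x - r \<le> a" "u \<bullet> y - r \<le> b"
        using conjugate_ge[of u x h] conjugate_ge[of u y h] real * by auto
      then have "(1 - s) * (u \<bullet> x - r) + s * (u \<bullet> y - r) \<le> (1 - s) * a + s * b"
        using * by (intro add_mono mult_left_mono) auto
      then show ?thesis using real by (simp add: inner_add_right algebra_simps)
    qed (use assms in \<open>auto simp: proper_fun_def\<close>)
  qed
qed

text \<open>A supremum of continuous affine functions: a term that exceeds \<open>c\<close> at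
  \<open>x\<close> still does so near \<open>x\<close>.\<close>

lemma lsc_fun_conjugate: "lsc_fun (conjugate h)"
  unfolding lsc_fun_iff_eventually
proof (intro allI impI)
  fix x c assume "c < conjugate h x"
  then obtain u where u: "c < ereal (u \<bullet> x) - h u"
    unfolding conjugate_def less_SUP_iff by auto
  have "\<forall>\<^sub>F y in nhds x. c < ereal (u \<bullet> y) - h u"
  proof (cases "h u")
    case (real r)
    have "((\<lambda>y. ereal (u \<bullet> y - r)) \<longlongrightarrow> ereal (u \<bullet> x - r)) (nhds x)"
      by (intro tendsto_intros filterlim_ident)
    from order_tendstoD(1)[OF this, of c] show ?thesis using u real by simp
  qed (use u in auto)
  then show "\<forall>\<^sub>F y in nhds x. c < conjugate h y"
    by eventually_elim (rule less_le_trans[OF _ conjugate_ge])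
qed

text \<open>Only finiteness at some point needs a new argument. The proximal inequality at 0 makes
  \<open>- p\<close> a subgradient of \<open>h\<close> at \<open>p\<close>, and the conjugate is
  finite at every subgradient.\<close>

lemma proper_lsc_convex_conjugate:
  fixes h :: "'a::{real_inner, complete_space} \<Rightarrow> ereal"
  assumes plc: "proper_lsc_convex h"
  shows "proper_lsc_convex (conjugate h)"
proof -
  have pr: "proper_fun h" using plc by (simp add: proper_lsc_convex_def)
  define p where "p = prox h 0"
  have "conjugate h (- p) \<le> ereal (- (p \<bullet> p) - real_of_ereal (h p))"
    unfolding conjugate_def
  proof (rule SUP_least)
    fix v
    show "ereal (v \<bullet> (- p)) - h v \<le> ereal (- (p \<bullet> p) - real_of_ereal (h p))"
    proof (cases "h v")
      case (real r)
      then show ?thesis using prox_subgradient[OF plc, of v 0]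
        by (simp add: p_def inner_diff_right inner_commute algebra_simps)
    qed (use pr in \<open>auto simp: proper_fun_def\<close>)
  qed
  then have "conjugate h (- p) \<noteq> \<infinity>" by auto
  then show ?thesis
    using conjugate_not_MInf[OF pr] convex_fun_conjugate[OF pr] lsc_fun_conjugate
    by (auto simp: proper_lsc_convex_def proper_fun_def)
qed

subsection \<open>Riesz representation, adjoint and projection\<close>

text \<open>The minimiser of \<open>|v|^2 / 2 - l v\<close> is the representing vector: its proximal
  inequality gives \<open>l d \<le> d \<bullet> p\<close>, and replacing \<open>d\<close> by
  \<open>- d\<close> yields equality.\<close>

lemma riesz_representation:
  fixes l :: "'a::{real_inner, complete_space} \<Rightarrow> real"
  assumes "bounded_linear l"
  shows "\<exists>v. \<forall>x. l x = x \<bullet> v"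
proof -
  interpret bounded_linear l by fact
  define h where "h v = ereal (- l v)" for v
  have "lsc_fun h"
    unfolding lsc_fun_iff_eventually
  proof (intro allI impI)
    fix x c assume c: "c < h x"
    have "((\<lambda>y. ereal (- l y)) \<longlongrightarrow> ereal (- l x)) (nhds x)"
      by (intro tendsto_intros filterlim_ident tendsto)
    then show "\<forall>\<^sub>F u in nhds x. c < h u"
      using order_tendstoD(1) c unfolding h_def by blast
  qed
  then have plc: "proper_lsc_convex h"
    by (auto simp: proper_lsc_convex_def proper_fun_def h_def convex_fun_def add scaleR)
  define p where "p = prox h 0"
  have le: "l d \<le> d \<bullet> p" for d
    using prox_subgradient[OF plc, of "p + d" 0]
    by (simp add: p_def[symmetric] h_def add inner_commute)
  have "l d = d \<bullet> p" for d using le[of d] le[of "- d"] by (simp add: linear_neg[OF bounded_linear.linear[OF assms]])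
  then show ?thesis by blast
qed

text \<open>\<open>adjoint\<close> is a Hilbert choice as well; Riesz representation of the
  functional \<open>A x \<bullet> y\<close> in \<open>x\<close> supplies an operator with the
  required property.\<close>

lemma inner_adjoint:
  fixes A :: "'a::{real_inner, complete_space} \<Rightarrow> 'b::real_inner"
  assumes "bounded_linear A"
  shows "x \<bullet> adjoint A y = A x \<bullet> y"
proof -
  have "\<exists>v. \<forall>x. A x \<bullet> y = x \<bullet> v" for y
    by (intro riesz_representation bounded_linear_compose[OF bounded_linear_inner_left assms])
  then have "\<exists>B. \<forall>x y. A x \<bullet> y = x \<bullet> B y" by metis
  then have "\<forall>x y. A x \<bullet> y = x \<bullet> adjoint A y" unfolding adjoint_def by (rule someI_ex)
  then show ?thesis by simp
qed

lemma norm_adjoint_le: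
  fixes A :: "'a::{real_inner, complete_space} \<Rightarrow> 'b::real_inner"
  assumes "bounded_linear A"
  shows "norm (adjoint A y) \<le> onorm A * norm y"
proof -
  let ?v = "adjoint A y"
  have "norm ?v * norm ?v = A ?v \<bullet> y"
    by (simp add: inner_adjoint[OF assms, symmetric] power2_norm_eq_inner flip: power2_eq_square)
  also have "\<dots> \<le> norm (A ?v) * norm y" by (rule norm_cauchy_schwarz)
  also have "\<dots> \<le> onorm A * norm ?v * norm y" by (intro mult_right_mono onorm assms) auto
  finally have "norm ?v * norm ?v \<le> norm ?v * (onorm A * norm y)" by (simp add: ac_simps)
  then show ?thesis
    using onorm_pos_le[OF assms] by (cases "norm ?v = 0") (auto simp: mult_le_cancel_left)
qed

text \<open>The nearest point is the proximal point of the indicator function of \<open>S\<close>,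
  which is lower semicontinuous because \<open>S\<close> is closed.\<close>

lemma closed_convex_projection:
  fixes S :: "'a::{real_inner, complete_space} set"
  assumes "closed S" "convex S" "S \<noteq> {}"
  shows "\<exists>p\<in>S. \<forall>w\<in>S. norm (u - p) \<le> norm (u - w)"
proof -
  define h where "h v = (if v \<in> S then 0 else \<infinity> :: ereal)" for v
  have "lsc_fun h"
    unfolding lsc_fun_iff_eventually
  proof (intro allI impI)
    fix x c assume c: "c < h x"
    show "\<forall>\<^sub>F u in nhds x. c < h u"
    proof (cases "x \<in> S")
      case True
      then show ?thesis using c by (auto simp: h_def intro!: always_eventually)
    next
      case False
      then have "\<forall>\<^sub>F u in nhds x. u \<in> - S"
        using assms(1) by (intro eventually_nhds_in_open) (auto simp: open_Compl)
      then show ?thesis by eventually_elim (use c False in \<open>auto simp: h_def\<close>)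
    qed
  qed
  moreover have "convex_fun h"
  proof (rule convex_funI)
    fix x y s a b assume "h x = ereal a" "h y = ereal b" "0 < s" "s < (1::real)"
    then have "x \<in> S" "y \<in> S" "a = 0" "b = 0" by (auto simp: h_def split: if_splits)
    then show "h ((1 - s) *\<^sub>R x + s *\<^sub>R y) \<le> ereal ((1 - s) * a + s * b)"
      using assms(2) \<open>0 < s\<close> \<open>s < 1\<close> by (auto simp: h_def convex_alt)
  qed (auto simp: h_def)
  moreover have "proper_fun h" using assms(3) by (auto simp: proper_fun_def h_def)
  ultimately obtain p where "h p \<noteq> \<infinity>"
    and p: "\<And>v. h p + ereal ((norm (u - p))\<^sup>2 / 2) \<le> h v + ereal ((norm (u - v))\<^sup>2 / 2)"
    using prox_exists[of h u] by (auto simp: proper_lsc_convex_def)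
  then have "p \<in> S" by (auto simp: h_def split: if_splits)
  moreover have "norm (u - p) \<le> norm (u - w)" if "w \<in> S" for w
    using p[of w] that \<open>p \<in> S\<close> by (simp add: h_def)
  ultimately show ?thesis by blast
qed

subsection \<open>The weighted norm\<close>

lemma norm_V_power2:
  "\<tau> > 0 \<Longrightarrow> \<sigma> > 0 \<Longrightarrow> (norm_V \<tau> \<sigma> z)\<^sup>2 = 1 / \<tau> * (norm (fst z))\<^sup>2 + 1 / \<sigma> * (norm (snd z))\<^sup>2"
  by (simp add: norm_V_def)

text \<open>An isometry from the product space with its standard norm onto the same space with
  \<open>norm_V\<close>. It carries over the projection, the triangle inequality and the radial
  projection onto a ball.\<close>

definition scale_V :: "real \<Rightarrow> real \<Rightarrow> 'a::real_vector \<times> 'b::real_vector \<Rightarrow> 'a \<times> 'b" where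
  "scale_V \<tau> \<sigma> z = (sqrt \<tau> *\<^sub>R fst z, sqrt \<sigma> *\<^sub>R snd z)"

lemma norm_V_scale_V:
  "\<tau> > 0 \<Longrightarrow> \<sigma> > 0 \<Longrightarrow> norm_V \<tau> \<sigma> (scale_V \<tau> \<sigma> z) = norm z"
  by (simp add: norm_V_def scale_V_def norm_prod_def power_mult_distrib)

lemma scale_V_surj:
  assumes "\<tau> > 0" "\<sigma> > 0"
  shows "\<exists>w. z = scale_V \<tau> \<sigma> w"
  using assms
  by (intro exI[of _ "(inverse (sqrt \<tau>) *\<^sub>R fst z, inverse (sqrt \<sigma>) *\<^sub>R snd z)"])
     (simp add: scale_V_def)

lemma bounded_linear_scale_V:
  "bounded_linear (scale_V \<tau> \<sigma> :: 'a::real_normed_vector \<times> 'b::real_normed_vector \<Rightarrow> _)"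
  unfolding scale_V_def
  by (intro bounded_linear_Pair bounded_linear_scaleR_right[THEN bounded_linear_compose]
      bounded_linear_fst bounded_linear_snd)

lemma norm_V_projection:
  fixes S :: "('a::{real_inner, complete_space} \<times> 'b::{real_inner, complete_space}) set"
  assumes "closed S" "convex S" "S \<noteq> {}" "\<tau> > 0" "\<sigma> > 0"
  shows "\<exists>p\<in>S. \<forall>w\<in>S. norm_V \<tau> \<sigma> (z - p) \<le> norm_V \<tau> \<sigma> (z - w)"
proof -
  let ?T = "scale_V \<tau> \<sigma> :: 'a \<times> 'b \<Rightarrow> _"
  interpret T: bounded_linear ?T by (rule bounded_linear_scale_V)
  obtain u where u: "z = ?T u" using scale_V_surj assms by blast
  have "closed (?T -` S)" using T.continuous_on[OF continuous_on_id] assms(1)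
    by (intro closed_vimage) auto
  moreover have "convex (?T -` S)" using assms(2) T.linear_axioms by (rule convex_linear_vimage[rotated])
  moreover have "?T -` S \<noteq> {}"
  proof -
    obtain s where "s \<in> S" using assms(3) by blast
    moreover obtain v where "s = ?T v" using scale_V_surj assms by blast
    ultimately show ?thesis by blast
  qed
  ultimately have "\<exists>q\<in>?T -` S. \<forall>w\<in>?T -` S. norm (u - q) \<le> norm (u - w)"
    by (rule closed_convex_projection)
  then obtain q where q: "?T q \<in> S" "\<And>w. ?T w \<in> S \<Longrightarrow> norm (u - q) \<le> norm (u - w)"
    by blast
  have eq: "norm_V \<tau> \<sigma> (z - ?T w) = norm (u - w)" for w
    unfolding u T.diff[symmetric] using norm_V_scale_V assms by blast
  show ?thesis
  proof (intro bexI ballI)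
    fix w assume "w \<in> S"
    obtain v where "w = ?T v" using scale_V_surj assms by blast
    then show "norm_V \<tau> \<sigma> (z - ?T q) \<le> norm_V \<tau> \<sigma> (z - w)"
      using eq q \<open>w \<in> S\<close> by auto
  qed (rule q)
qed

lemma norm_V_triangle:
  assumes "\<tau> > 0" "\<sigma> > 0"
  shows "norm_V \<tau> \<sigma> (z + w) \<le> norm_V \<tau> \<sigma> z + norm_V \<tau> \<sigma> w"
proof -
  interpret T: bounded_linear "scale_V \<tau> \<sigma> :: 'a \<times> 'b \<Rightarrow> _" by (rule bounded_linear_scale_V)
  obtain u v where "z = scale_V \<tau> \<sigma> u" "w = scale_V \<tau> \<sigma> v" using scale_V_surj assms by metis
  then show ?thesis using norm_triangle_ineq[of u v] assms by (simp flip: T.add add: norm_V_scale_V)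
qed

lemma norm_V_nonneg: "norm_V \<tau> \<sigma> z \<ge> 0" if "\<tau> > 0" "\<sigma> > 0"
  using that by (simp add: norm_V_def)

section \<open>Distance and projection in the weighted norm\<close>

lemma dist_V_le:
  assumes "w \<in> S" "\<tau> > 0" "\<sigma> > 0"
  shows "dist_V \<tau> \<sigma> z S \<le> norm_V \<tau> \<sigma> (z - w)"
  unfolding dist_V_def using assms
  by (intro cINF_lower bdd_belowI[of _ 0]) (auto intro: norm_V_nonneg)

lemma dist_V_nonneg:
  assumes "S \<noteq> {}" "\<tau> > 0" "\<sigma> > 0"
  shows "dist_V \<tau> \<sigma> z S \<ge> 0"
  unfolding dist_V_def using assms by (intro cINF_greatest norm_V_nonneg)

lemma dist_V_triangle:
  assumes "S \<noteq> {}" "\<tau> > 0" "\<sigma> > 0"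
  shows "dist_V \<tau> \<sigma> z S \<le> dist_V \<tau> \<sigma> w S + norm_V \<tau> \<sigma> (z - w)"
proof -
  have "dist_V \<tau> \<sigma> z S - norm_V \<tau> \<sigma> (z - w) \<le> norm_V \<tau> \<sigma> (w - v)" if "v \<in> S" for v
    using dist_V_le[OF that assms(2,3), of z] norm_V_triangle[OF assms(2,3), of "z - w" "w - v"]
    by simp
  then have "dist_V \<tau> \<sigma> z S - norm_V \<tau> \<sigma> (z - w) \<le> dist_V \<tau> \<sigma> w S"
    unfolding dist_V_def using assms(1) by (intro cINF_greatest) auto
  then show ?thesis by simp
qed

lemma proj_V:
  fixes S :: "('a::{real_inner, complete_space} \<times> 'b::{real_inner, complete_space}) set"
  assumes "closed S" "convex S" "S \<noteq> {}" "\<tau> > 0" "\<sigma> > 0"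
  shows proj_V_in: "proj_V \<tau> \<sigma> S z \<in> S"
    and norm_V_proj_V: "norm_V \<tau> \<sigma> (z - proj_V \<tau> \<sigma> S z) = dist_V \<tau> \<sigma> z S"
proof -
  obtain p where "p \<in> S" "\<forall>w\<in>S. norm_V \<tau> \<sigma> (z - p) \<le> norm_V \<tau> \<sigma> (z - w)"
    using norm_V_projection[OF assms] by blast
  then have "is_arg_min (\<lambda>w. norm_V \<tau> \<sigma> (z - w)) (\<lambda>w. w \<in> S) p"
    by (auto simp: is_arg_min_linorder)
  then have *: "is_arg_min (\<lambda>w. norm_V \<tau> \<sigma> (z - w)) (\<lambda>w. w \<in> S) (proj_V \<tau> \<sigma> S z)"
    unfolding proj_V_def arg_min_on_def arg_min_def by (rule someI)
  then show "proj_V \<tau> \<sigma> S z \<in> S" by (simp add: is_arg_min_linorder)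
  then show "norm_V \<tau> \<sigma> (z - proj_V \<tau> \<sigma> S z) = dist_V \<tau> \<sigma> z S"
    using * unfolding dist_V_def is_arg_min_linorder
    by (intro antisym cINF_greatest dist_V_le[unfolded dist_V_def] assms) auto
qed

subsection \<open>Smooth convex functions\<close>

lemma lipschitz_smooth_finite:
  assumes "lipschitz_smooth L h"
  shows "\<bar>h x\<bar> \<noteq> \<infinity>"
proof -
  obtain D where "has_gradient h x D" using assms by (auto simp: lipschitz_smooth_def)
  then show ?thesis unfolding has_gradient_def by (metis eventually_nhds_x_imp_x)
qed

lemma has_gradient_unique:
  assumes "has_gradient h x D" "has_gradient h x D'"
  shows "D = D'"
proof -
  have "(\<lambda>u. u \<bullet> D) = (\<lambda>u. u \<bullet> D')"
    using assms unfolding has_gradient_def gderiv_def by (meson has_derivative_unique)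
  then have "(D - D') \<bullet> D = (D - D') \<bullet> D'" by meson
  then have "(D - D') \<bullet> (D - D') = 0" by (simp add: inner_diff_right)
  then show ?thesis by simp
qed

lemma lipschitz_smooth_GDERIV:
  assumes "lipschitz_smooth L h"
  shows "GDERIV (\<lambda>u. real_of_ereal (h u)) x :> gradient h x"
proof -
  obtain D where "has_gradient h x D" using assms by (auto simp: lipschitz_smooth_def)
  then have "has_gradient h x (gradient h x)"
    unfolding gradient_def by (rule theI) (rule has_gradient_unique[OF _ \<open>has_gradient h x D\<close>])
  then show ?thesis by (simp add: has_gradient_def)
qed

lemma lipschitz_smooth_DERIV_line:
  assumes "lipschitz_smooth L h"
  shows "((\<lambda>t. real_of_ereal (h (x + t *\<^sub>R d))) has_real_derivative gradient h (x + t *\<^sub>R d) \<bullet> d) (at t)"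
proof -
  have "((\<lambda>t. x + t *\<^sub>R d) has_derivative (\<lambda>s. s *\<^sub>R d)) (at t)"
    by (auto intro!: derivative_eq_intros)
  moreover have "((\<lambda>u. real_of_ereal (h u)) has_derivative (\<lambda>u. u \<bullet> gradient h (x + t *\<^sub>R d)))
      (at (x + t *\<^sub>R d))"
    using lipschitz_smooth_GDERIV[OF assms] by (simp add: gderiv_def)
  ultimately have "((\<lambda>t. real_of_ereal (h (x + t *\<^sub>R d))) has_derivative
      (\<lambda>s. (s *\<^sub>R d) \<bullet> gradient h (x + t *\<^sub>R d))) (at t)"
    by (rule has_derivative_compose)
  then show ?thesis
    by (rule has_derivative_imp_has_field_derivative) (simp add: inner_commute)
qed

text \<open>Along the segment the difference of the two sides is \<open>\<psi>\<close> up to a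
  constant. Its derivative is nonpositive by the Lipschitz bound and Cauchy-Schwarz, and comparing
  end values replaces integrating the gradient.\<close>

lemma descent_lemma:
  assumes sm: "lipschitz_smooth L h"
  shows "real_of_ereal (h (x + d)) \<le> real_of_ereal (h x) + gradient h x \<bullet> d + L / 2 * (norm d)\<^sup>2"
proof -
  define \<psi> where "\<psi> t = real_of_ereal (h (x + t *\<^sub>R d)) - t * (gradient h x \<bullet> d) - L / 2 * t\<^sup>2 * (norm d)\<^sup>2" for t
  have "\<psi> 0 \<ge> \<psi> 1"
  proof (rule DERIV_nonpos_imp_nonincreasing[of 0 1 \<psi>])
    fix t :: real assume t: "0 \<le> t" "t \<le> 1"
    let ?D = "gradient h (x + t *\<^sub>R d) \<bullet> d - gradient h x \<bullet> d - L * t * (norm d)\<^sup>2"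
    have "(\<psi> has_real_derivative ?D) (at t)"
      unfolding \<psi>_def by (auto intro!: derivative_eq_intros lipschitz_smooth_DERIV_line[OF sm])
    moreover have "?D \<le> 0"
    proof -
      have "L-lipschitz_on UNIV (gradient h)" using sm by (simp add: lipschitz_smooth_def)
      from lipschitz_onD[OF this, of "x + t *\<^sub>R d" x]
      have "norm (gradient h (x + t *\<^sub>R d) - gradient h x) \<le> L * (t * norm d)"
        using t by (simp add: dist_norm)
      then have "norm (gradient h (x + t *\<^sub>R d) - gradient h x) * norm d \<le> L * (t * norm d) * norm d"
        by (rule mult_right_mono) simp
      moreover have "(gradient h (x + t *\<^sub>R d) - gradient h x) \<bullet> d
          \<le> norm (gradient h (x + t *\<^sub>R d) - gradient h x) * norm d"
        by (rule norm_cauchy_schwarz)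
      ultimately show ?thesis by (simp add: inner_diff_left power2_eq_square)
    qed
    ultimately show "\<exists>y. (\<psi> has_real_derivative y) (at t) \<and> y \<le> 0" by blast
  qed simp
  then show ?thesis by (simp add: \<psi>_def)
qed

text \<open>On the line through \<open>x\<close> and \<open>y\<close> this is the tangent inequality
  for a convex function of one variable.\<close>

lemma gradient_inequality:
  assumes cv: "convex_fun h" and sm: "lipschitz_smooth L h"
  shows "real_of_ereal (h x) + gradient h x \<bullet> (y - x) \<le> real_of_ereal (h y)"
proof -
  have fin: "h u \<noteq> \<infinity>" "h u \<noteq> -\<infinity>" for u using lipschitz_smooth_finite[OF sm, of u] by auto
  then have pr: "proper_fun h" by (auto simp: proper_fun_def)
  let ?d = "y - x"
  have "convex_on UNIV (\<lambda>t. real_of_ereal (h (x + t *\<^sub>R ?d)))"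
  proof (rule convex_onI)
    fix s t u :: real assume s: "0 < s" "s < 1"
    have "x + ((1 - s) *\<^sub>R t + s *\<^sub>R u) *\<^sub>R ?d = (1 - s) *\<^sub>R (x + t *\<^sub>R ?d) + s *\<^sub>R (x + u *\<^sub>R ?d)"
      by (simp add: scaleR_add_left scaleR_diff_left scaleR_add_right)
    then show "real_of_ereal (h (x + ((1 - s) *\<^sub>R t + s *\<^sub>R u) *\<^sub>R ?d))
      \<le> (1 - s) * real_of_ereal (h (x + t *\<^sub>R ?d)) + s * real_of_ereal (h (x + u *\<^sub>R ?d))"
      using convex_fun_real_le[OF pr cv fin(1) fin(1), of s "x + t *\<^sub>R ?d" "x + u *\<^sub>R ?d"] s by simp
  qed simp
  from convex_on_imp_above_tangent[OF this _ _ _ lipschitz_smooth_DERIV_line[OF sm, of x ?d 0], of 1]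
  show ?thesis by simp
qed

text \<open>
  The proof of the Baillon-Haddad inequality with the displacement \<open>w = (v - x) / 2\<close> in place of the
  optimal one, which would require dividing by \<open>L\<close> although \<open>L\<close> may vanish.
\<close>

lemma gradient_three_point:
  assumes cv: "convex_fun h" and sm: "lipschitz_smooth L h"
  shows "- (L / 4 * (norm (v - x))\<^sup>2) \<le> (gradient h x - gradient h s) \<bullet> (v - s)"
proof -
  define w where "w = (1/2) *\<^sub>R (v - x)"
  have v: "v = x + 2 *\<^sub>R w" by (simp add: w_def)
  have "(norm (v - x))\<^sup>2 = 4 * (norm w)\<^sup>2" by (simp add: v power_mult_distrib)
  moreover
  \<comment> \<open>With the test points \<open>x + w\<close> and \<open>s - w\<close> all values of
    \<open>h\<close> cancel in the sum, and the gradients are paired with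
    \<open>x + 2 w - s\<close>, which is \<open>v - s\<close>.\<close>
  have "real_of_ereal (h s) + gradient h s \<bullet> (x + w - s) \<le> real_of_ereal (h (x + w))"
    "real_of_ereal (h x) + gradient h x \<bullet> (s - w - x) \<le> real_of_ereal (h (s - w))"
    using gradient_inequality[OF cv sm] by blast+
  moreover have "real_of_ereal (h (x + w)) \<le> real_of_ereal (h x) + gradient h x \<bullet> w + L / 2 * (norm w)\<^sup>2"
    "real_of_ereal (h (s - w)) \<le> real_of_ereal (h s) - gradient h s \<bullet> w + L / 2 * (norm w)\<^sup>2"
    using descent_lemma[OF sm, of x w] descent_lemma[OF sm, of s "- w"] by simp_all
  ultimately show ?thesis
    unfolding v by (simp add: inner_simps algebra_simps)
qed

subsection \<open>Identities and inequalities in inner product spaces\<close>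

text \<open>With \<open>xp = xb\<close> this is the usual three-point identity. A separate
  \<open>xp\<close> is for the primal variable, whose update is corrected after the proximal step;
  the last square is the cost of that correction.\<close>

lemma four_point_identity:
  fixes x xp xb v :: "'a::real_inner"
  shows "2 * ((x - xp) \<bullet> (xb - v))
    = (norm (x - v))\<^sup>2 - (norm (xp - v))\<^sup>2 - (norm (xb - x))\<^sup>2 + (norm (xp - xb))\<^sup>2"
  unfolding power2_norm_eq_inner
  by (simp add: inner_diff_left inner_diff_right 
    inner_commute[of v x] inner_commute[of v xp] inner_commute[of xb x] inner_commute[of xb xp]
    inner_commute[of xp x])

text \<open>Recentring: squares around a test point \<open>v\<close> become squares around a saddle
  point \<open>s\<close> plus a term linear in \<open>v - s\<close>, which the penalty of the
  smoothed gap can absorb.\<close>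

lemma norm_sq_diff_shift:
  fixes x xp v s :: "'a::real_inner"
  shows "(norm (x - v))\<^sup>2 - (norm (xp - v))\<^sup>2
    = (norm (x - s))\<^sup>2 - (norm (xp - s))\<^sup>2 + 2 * ((xp - x) \<bullet> (v - s))"
  unfolding power2_norm_eq_inner
  by (simp add: inner_diff_left inner_diff_right 
    inner_commute[of v x] inner_commute[of v xp] inner_commute[of s x] inner_commute[of s xp])

text \<open>The witness is the radial projection onto the ball. At the projected point the angle
  between the directions to \<open>zb\<close> and to \<open>zp\<close> is not acute, so passing from
  \<open>zb\<close> to it does not increase the distance to \<open>zp\<close>.\<close>

lemma ball_projection_step:
  fixes zb zp :: "'a::real_inner"
  assumes "norm zp \<le> r"
  shows "\<exists>t\<ge>0. t \<le> 1 \<and> norm (t *\<^sub>R zb) \<le> r \<and> norm (t *\<^sub>R zb - zp) \<le> norm (zb - zp)"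
proof (cases "norm zb \<le> r")
  case True
  then show ?thesis by (intro exI[of _ 1]) auto
next
  case False
  have r: "0 \<le> r" using assms norm_ge_zero[of zp] by linarith
  define t where "t = r / norm zb"
  have "0 < norm zb" "r \<le> norm zb" using False r by linarith+
  then have t: "0 \<le> t" "t \<le> 1" and rt: "r = t * norm zb"
    using r by (simp_all add: t_def divide_le_eq_1)
  have "zb \<bullet> zp \<le> norm zb * norm zp" by (rule norm_cauchy_schwarz)
  also have "\<dots> \<le> norm zb * r" using assms by (intro mult_left_mono) auto
  finally have "zb \<bullet> zp \<le> t * (norm zb)\<^sup>2" by (simp add: rt power2_eq_square mult.left_commute)
  then have "0 \<le> (1 - t)\<^sup>2 * (norm zb)\<^sup>2 + 2 * ((1 - t) * (t * (norm zb)\<^sup>2 - zb \<bullet> zp))"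
    using t by (intro add_nonneg_nonneg mult_nonneg_nonneg) auto
  also have "\<dots> = (norm (zb - zp))\<^sup>2 - (norm (t *\<^sub>R zb - zp))\<^sup>2"
    unfolding power2_norm_eq_inner
    by (simp add: inner_diff_left inner_diff_right inner_commute[of zp zb] power2_eq_square algebra_simps)
  finally have "(norm (t *\<^sub>R zb - zp))\<^sup>2 \<le> (norm (zb - zp))\<^sup>2" by simp
  then have "norm (t *\<^sub>R zb - zp) \<le> norm (zb - zp)" by (rule power2_le_imp_le) simp
  then show ?thesis using t rt by (intro exI[of _ t]) auto
qed

lemma norm_V_ball_projection_step:
  fixes c zb zp :: "'a::real_inner \<times> 'b::real_inner"
  assumes "\<tau> > 0" "\<sigma> > 0" "norm_V \<tau> \<sigma> (zp - c) \<le> r"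
  shows "\<exists>t\<ge>0. t \<le> 1 \<and> norm_V \<tau> \<sigma> ((1 - t) *\<^sub>R c + t *\<^sub>R zb - c) \<le> r \<and>
    norm_V \<tau> \<sigma> (zp - ((1 - t) *\<^sub>R c + t *\<^sub>R zb)) \<le> norm_V \<tau> \<sigma> (zp - zb)"
proof -
  interpret T: bounded_linear "scale_V \<tau> \<sigma> :: 'a \<times> 'b \<Rightarrow> _" by (rule bounded_linear_scale_V)
  obtain p where p: "zp - c = scale_V \<tau> \<sigma> p" using scale_V_surj assms by blast
  obtain b where b: "zb - c = scale_V \<tau> \<sigma> b" using scale_V_surj assms by blast
  note n = norm_V_scale_V[OF assms(1,2)]
  obtain t where t: "t \<ge> 0" "t \<le> 1" "norm (t *\<^sub>R b) \<le> r" "norm (t *\<^sub>R b - p) \<le> norm (b - p)"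
    using ball_projection_step[of p r b] assms(3) unfolding p n by blast
  have "(1 - t) *\<^sub>R c + t *\<^sub>R zb - c = t *\<^sub>R (zb - c)" by (simp add: algebra_simps)
  then have 1: "(1 - t) *\<^sub>R c + t *\<^sub>R zb - c = scale_V \<tau> \<sigma> (t *\<^sub>R b)" by (simp add: b T.scaleR)
  have "zp - ((1 - t) *\<^sub>R c + t *\<^sub>R zb) = (zp - c) - t *\<^sub>R (zb - c)" by (simp add: algebra_simps)
  then have 2: "zp - ((1 - t) *\<^sub>R c + t *\<^sub>R zb) = scale_V \<tau> \<sigma> (p - t *\<^sub>R b)" by (simp add: b p T.scaleR T.diff)
  have "zp - zb = (zp - c) - (zb - c)" by simp
  then have 3: "zp - zb = scale_V \<tau> \<sigma> (p - b)" by (simp add: b p T.diff)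
  show ?thesis using t unfolding 1 2 3 n
    by (intro exI[of _ t]) (simp add: 1 2 n norm_minus_commute)
qed

subsection \<open>One proximal gradient step\<close>

text \<open>Moving the fraction \<open>s\<close> of the way to \<open>u\<close> changes the smooth
  part by its linearisation up to order \<open>s\<^sup>2\<close>; dividing by \<open>s\<close>
  leaves the optimality condition.\<close>

lemma composite_minimizer_subgradient:
  assumes pr: "proper_fun f" and cv: "convex_fun f" and sm: "lipschitz_smooth L \<phi>"
    and x: "f x \<noteq> \<infinity>" and u: "f u \<noteq> \<infinity>"
    and min: "\<And>u. f u \<noteq> \<infinity> \<Longrightarrow> real_of_ereal (f x) + real_of_ereal (\<phi> x) + b \<bullet> x
      \<le> real_of_ereal (f u) + real_of_ereal (\<phi> u) + b \<bullet> u"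
  shows "real_of_ereal (f x) - (gradient \<phi> x + b) \<bullet> (u - x) \<le> real_of_ereal (f u)"
proof (rule le_of_le_add_small)
  fix s :: real assume s: "0 < s" "s \<le> 1"
  let ?w = "(1 - s) *\<^sub>R x + s *\<^sub>R u"
  have w: "?w = x + s *\<^sub>R (u - x)" by (simp add: algebra_simps)
  have "real_of_ereal (\<phi> ?w) \<le> real_of_ereal (\<phi> x) + s * (gradient \<phi> x \<bullet> (u - x))
      + L / 2 * (s * norm (u - x))\<^sup>2"
    unfolding w using descent_lemma[OF sm, of x "s *\<^sub>R (u - x)"] s by simp
  moreover have "b \<bullet> ?w = b \<bullet> x + s * (b \<bullet> (u - x))" unfolding w by (simp add: inner_add_right)
  moreover have "f ?w \<noteq> \<infinity>" and
    "real_of_ereal (f ?w) \<le> (1 - s) * real_of_ereal (f x) + s * real_of_ereal (f u)"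
    using convex_fun_real[OF pr cv x u] s by auto
  moreover note min[OF \<open>f ?w \<noteq> \<infinity>\<close>]
  ultimately have "0 \<le> s * (real_of_ereal (f u) - real_of_ereal (f x) + (gradient \<phi> x + b) \<bullet> (u - x)
      + s * (L / 2 * (norm (u - x))\<^sup>2))"
    by (simp add: inner_add_left power_mult_distrib power2_eq_square algebra_simps)
  then show "real_of_ereal (f x) - (gradient \<phi> x + b) \<bullet> (u - x)
      \<le> real_of_ereal (f u) + s * (L / 2 * (norm (u - x))\<^sup>2)"
    using s by (simp add: zero_le_mult_iff)
qed

lemma prox_scaled:
  fixes f :: "'a::{real_inner, complete_space} \<Rightarrow> ereal"
  assumes plc: "proper_lsc_convex f" and t: "t > 0"
  defines "v \<equiv> \<lambda>q. prox (\<lambda>u. ereal t * f u) q"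
  shows prox_scaled_finite: "f (v q) \<noteq> \<infinity>"
    and prox_scaled_subgradient:
      "f u \<noteq> \<infinity> \<Longrightarrow> real_of_ereal (f (v q)) + 1 / t * ((q - v q) \<bullet> (u - v q)) \<le> real_of_ereal (f u)"
proof -
  have plc': "proper_lsc_convex (\<lambda>u. ereal t * f u)" by (rule proper_lsc_convex_scale[OF plc t])
  show fin: "f (v q) \<noteq> \<infinity>"
    using prox_finite[OF plc', of q] t by (auto simp: v_def)
  assume u: "f u \<noteq> \<infinity>"
  then have "ereal t * f u \<noteq> \<infinity>" using t by (cases "f u") auto
  from prox_subgradient[OF plc' this, of q]
  have "t * real_of_ereal (f (v q)) + (q - v q) \<bullet> (u - v q) \<le> t * real_of_ereal (f u)"
    by (simp add: v_def)
  then show "real_of_ereal (f (v q)) + 1 / t * ((q - v q) \<bullet> (u - v q)) \<le> real_of_ereal (f u)"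
    using t by (simp add: field_simps)
qed

text \<open>One statement for both updates: \<open>b\<close> is the coupling term of the primal or
  of the dual step. The second part pays \<open>L / 2\<close> through the descent lemma and serves
  the gap; the third compares with an optimal \<open>s\<close>, pays only \<open>L / 4\<close> by
  \<open>gradient_three_point\<close>, and serves the decrease of distances.\<close>

lemma prox_gradient_step:
  fixes f \<phi> :: "'a::{real_inner, complete_space} \<Rightarrow> ereal"
  assumes plc: "proper_lsc_convex f" and cv: "convex_fun \<phi>" and sm: "lipschitz_smooth L \<phi>"
    and t: "t > 0"
    and v: "v = prox (\<lambda>u. ereal t * f u) (x - t *\<^sub>R gradient \<phi> x - t *\<^sub>R b)"
  shows prox_gradient_step_finite: "f v \<noteq> \<infinity>"
    and prox_gradient_step_le: "f u \<noteq> \<infinity> \<Longrightarrow>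
      real_of_ereal (f v) + real_of_ereal (\<phi> v) + 1 / t * ((x - v) \<bullet> (u - v)) - b \<bullet> (u - v)
        - L / 2 * (norm (v - x))\<^sup>2 \<le> real_of_ereal (f u) + real_of_ereal (\<phi> u)"
    and prox_gradient_step_monotone: "f s \<noteq> \<infinity> \<Longrightarrow>
      (\<And>u. f u \<noteq> \<infinity> \<Longrightarrow>
        real_of_ereal (f s) - (gradient \<phi> s + bs) \<bullet> (u - s) \<le> real_of_ereal (f u)) \<Longrightarrow>
      - (L / 4 * (norm (v - x))\<^sup>2) \<le> 1 / t * ((x - v) \<bullet> (v - s)) - b \<bullet> (v - s) + bs \<bullet> (v - s)"
proof -
  show fin: "f v \<noteq> \<infinity>" unfolding v by (rule prox_scaled_finite[OF plc t])
  have sub: "real_of_ereal (f v) + 1 / t * ((x - v) \<bullet> (u - v)) - gradient \<phi> x \<bullet> (u - v) - b \<bullet> (u - v)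
      \<le> real_of_ereal (f u)" if "f u \<noteq> \<infinity>" for u
  proof -
    have "1 / t * ((x - t *\<^sub>R gradient \<phi> x - t *\<^sub>R b - v) \<bullet> (u - v))
        = 1 / t * ((x - v) \<bullet> (u - v)) - gradient \<phi> x \<bullet> (u - v) - b \<bullet> (u - v)"
      using t by (simp add: inner_diff_left inner_add_left field_simps)
    then show ?thesis
      using prox_scaled_subgradient[OF plc t that, of "x - t *\<^sub>R gradient \<phi> x - t *\<^sub>R b"]
      unfolding v[symmetric] by simp
  qed
  show "real_of_ereal (f v) + real_of_ereal (\<phi> v) + 1 / t * ((x - v) \<bullet> (u - v)) - b \<bullet> (u - v)
        - L / 2 * (norm (v - x))\<^sup>2 \<le> real_of_ereal (f u) + real_of_ereal (\<phi> u)" if "f u \<noteq> \<infinity>"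
    using sub[OF that] gradient_inequality[OF cv sm, of x u] descent_lemma[OF sm, of x "v - x"]
    by (simp add: inner_diff_right)
  show "- (L / 4 * (norm (v - x))\<^sup>2) \<le> 1 / t * ((x - v) \<bullet> (v - s)) - b \<bullet> (v - s) + bs \<bullet> (v - s)"
    if s: "f s \<noteq> \<infinity>" and min: "\<And>u. f u \<noteq> \<infinity> \<Longrightarrow>
        real_of_ereal (f s) - (gradient \<phi> s + bs) \<bullet> (u - s) \<le> real_of_ereal (f u)"
  proof -
    have neg: "a \<bullet> (s - v) = - (a \<bullet> (v - s))" for a by (simp add: inner_diff_right)
    show ?thesis
      using sub[OF s] min[OF fin] gradient_three_point[OF cv sm, of v x s]
      by (simp add: neg inner_add_left inner_diff_left diff_divide_distrib)
  qed
qed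

subsection \<open>The saddle point set\<close>

text \<open>The dual assumptions are stated for the conjugates, through which \<open>g\<close> and
  \<open>g2\<close> enter the Lagrangian; the pairs \<open>f\<close>, \<open>f2\<close> and
  \<open>h\<close>, \<open>h2\<close> can then be handled by the same lemmas.\<close>

locale saddle_problem =
  fixes A :: "'a::{real_inner, complete_space} \<Rightarrow> 'b::{real_inner, complete_space}"
    and f f2 :: "'a \<Rightarrow> ereal" and g g2 :: "'b \<Rightarrow> ereal" and Lf Lg :: real
  assumes bounded_linear_A: "bounded_linear A"
    and plc_f: "proper_lsc_convex f" and convex_f2: "convex_fun f2"
    and plc_g: "proper_lsc_convex (conjugate g)" and convex_g2: "convex_fun (conjugate g2)"
    and smooth_f2: "lipschitz_smooth Lf f2" and smooth_g2: "lipschitz_smooth Lg (conjugate g2)"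
begin

abbreviation "L \<equiv> lagrangian A f f2 g g2"
abbreviation "h \<equiv> conjugate g"
abbreviation "h2 \<equiv> conjugate g2"

text \<open>Real-valued parts of the Lagrangian. As \<open>real_of_ereal\<close> sends
  \<open>\<infinity>\<close> to 0, they are meaningful only where \<open>f\<close> and
  \<open>h\<close> are finite; there \<open>gap x y x' y'\<close> is
  \<open>L x y' - L x' y\<close>.\<close>

definition "F x = real_of_ereal (f x) + real_of_ereal (f2 x)"
definition "H y = real_of_ereal (h y) + real_of_ereal (h2 y)"

definition "gap x y x' y' = F x + A x \<bullet> y' - H y' - (F x' + A x' \<bullet> y - H y)"

interpretation A: bounded_linear A by (rule bounded_linear_A)

lemma proper_f: "proper_fun f" and convex_f: "convex_fun f"
  and proper_h: "proper_fun h" and convex_h: "convex_fun h"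
  using plc_f plc_g by (auto simp: proper_lsc_convex_def)

lemma lagrangian_cases:
  shows lagrangian_PInf: "f x = \<infinity> \<Longrightarrow> L x y = \<infinity>"
    and lagrangian_MInf: "f x \<noteq> \<infinity> \<Longrightarrow> h y = \<infinity> \<Longrightarrow> L x y = -\<infinity>"
    and lagrangian_real: "f x \<noteq> \<infinity> \<Longrightarrow> h y \<noteq> \<infinity> \<Longrightarrow> L x y = ereal (F x + A x \<bullet> y - H y)"
proof -
  obtain a b where ab: "f2 x = ereal a" "h2 y = ereal b"
    using lipschitz_smooth_finite[OF smooth_f2, of x] lipschitz_smooth_finite[OF smooth_g2, of y]
    by (cases "f2 x"; cases "h2 y") auto
  have nm: "f x \<noteq> -\<infinity>" "h y \<noteq> -\<infinity>" using proper_f proper_h by (auto simp: proper_fun_def)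
  show "f x = \<infinity> \<Longrightarrow> L x y = \<infinity>"
    using ab nm by (cases "h y") (auto simp: lagrangian_def)
  show "f x \<noteq> \<infinity> \<Longrightarrow> h y = \<infinity> \<Longrightarrow> L x y = -\<infinity>"
    using ab nm by (cases "f x") (auto simp: lagrangian_def)
  show "f x \<noteq> \<infinity> \<Longrightarrow> h y \<noteq> \<infinity> \<Longrightarrow> L x y = ereal (F x + A x \<bullet> y - H y)"
    using ab nm by (cases "f x"; cases "h y") (auto simp: lagrangian_def F_def H_def)
qed

text \<open>Chaining the two saddle inequalities gives \<open>L x y' \<le> L x' y\<close>; testing
  this at a point of both domains excludes infinite values, and real arithmetic remains. For the
  converse, one component of the competitor is kept equal to that of the point.\<close>

lemma saddle_points_iff:
  "(x, y) \<in> saddle_points L \<longleftrightarrow> f x \<noteq> \<infinity> \<and> h y \<noteq> \<infinity> \<and>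
    (\<forall>x' y'. f x' \<noteq> \<infinity> \<longrightarrow> h y' \<noteq> \<infinity> \<longrightarrow> gap x y x' y' \<le> 0)"
proof
  assume "(x, y) \<in> saddle_points L"
  then have le: "L x y' \<le> L x' y" for x' y'
    unfolding saddle_points_def by (auto intro: order_trans)
  obtain x0 y0 where 0: "f x0 \<noteq> \<infinity>" "h y0 \<noteq> \<infinity>"
    using proper_f proper_h by (auto simp: proper_fun_def)
  have x: "f x \<noteq> \<infinity>"
  proof
    assume "f x = \<infinity>"
    then have "L x0 y = \<infinity>" using le[of y0 x0] lagrangian_PInf by simp
    then show False using lagrangian_MInf[OF 0(1)] lagrangian_real[OF 0(1)] by (cases "h y = \<infinity>") auto
  qed
  have y: "h y \<noteq> \<infinity>"
    using le[of y0 x0] lagrangian_MInf[OF 0(1), of y] lagrangian_real[OF x 0(2)] by auto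
  have "gap x y x' y' \<le> 0" if "f x' \<noteq> \<infinity>" "h y' \<noteq> \<infinity>" for x' y'
    using le[of y' x'] lagrangian_real[OF x that(2)] lagrangian_real[OF that(1) y]
    by (simp add: gap_def)
  then show "f x \<noteq> \<infinity> \<and> h y \<noteq> \<infinity> \<and>
    (\<forall>x' y'. f x' \<noteq> \<infinity> \<longrightarrow> h y' \<noteq> \<infinity> \<longrightarrow> gap x y x' y' \<le> 0)"
    using x y by blast
next
  assume *: "f x \<noteq> \<infinity> \<and> h y \<noteq> \<infinity> \<and>
    (\<forall>x' y'. f x' \<noteq> \<infinity> \<longrightarrow> h y' \<noteq> \<infinity> \<longrightarrow> gap x y x' y' \<le> 0)"
  then have x: "f x \<noteq> \<infinity>" and y: "h y \<noteq> \<infinity>" by auto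
  have "L x y' \<le> L x y" for y'
    using lagrangian_MInf[OF x, of y'] lagrangian_real[OF x, of y'] lagrangian_real[OF x y] * x
    by (cases "h y' = \<infinity>") (auto simp: gap_def)
  moreover have "L x y \<le> L x' y" for x'
    using lagrangian_PInf[of x' y] lagrangian_real[OF _ y, of x'] lagrangian_real[OF x y] * y
    by (cases "f x' = \<infinity>") (auto simp: gap_def)
  ultimately show "(x, y) \<in> saddle_points L" by (auto simp: saddle_points_def)
qed

lemma F_convex:
  assumes "f x \<noteq> \<infinity>" "f u \<noteq> \<infinity>" "0 \<le> s" "s \<le> 1"
  shows "F ((1 - s) *\<^sub>R x + s *\<^sub>R u) \<le> (1 - s) * F x + s * F u"
proof -
  have fin: "f2 u \<noteq> \<infinity>" "f2 u \<noteq> -\<infinity>" for u using lipschitz_smooth_finite[OF smooth_f2, of u] by auto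
  then have "proper_fun f2" by (auto simp: proper_fun_def)
  from convex_fun_real_le[OF this convex_f2 fin(1) fin(1) assms(3,4), of x u]
    convex_fun_real_le[OF proper_f convex_f assms]
  show ?thesis by (simp add: F_def algebra_simps)
qed

lemma H_convex:
  assumes "h y \<noteq> \<infinity>" "h v \<noteq> \<infinity>" "0 \<le> s" "s \<le> 1"
  shows "H ((1 - s) *\<^sub>R y + s *\<^sub>R v) \<le> (1 - s) * H y + s * H v"
proof -
  have fin: "h2 u \<noteq> \<infinity>" "h2 u \<noteq> -\<infinity>" for u using lipschitz_smooth_finite[OF smooth_g2, of u] by auto
  then have "proper_fun h2" by (auto simp: proper_fun_def)
  from convex_fun_real_le[OF this convex_g2 fin(1) fin(1) assms(3,4), of y v]
    convex_fun_real_le[OF proper_h convex_h assms]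
  show ?thesis by (simp add: H_def algebra_simps)
qed

text \<open>\<open>F\<close> and \<open>H\<close> are convex and the coupling is affine in each
  argument. This carries the gap estimate from the intermediate point to the segment towards a
  saddle point.\<close>

lemma gap_convex:
  assumes "f x \<noteq> \<infinity>" "h y \<noteq> \<infinity>" "f u \<noteq> \<infinity>" "h v \<noteq> \<infinity>" "0 \<le> s" "s \<le> 1"
  shows "gap ((1 - s) *\<^sub>R x + s *\<^sub>R u) ((1 - s) *\<^sub>R y + s *\<^sub>R v) x' y'
    \<le> (1 - s) * gap x y x' y' + s * gap u v x' y'"
proof -
  define p q where "p = (1 - s) *\<^sub>R x + s *\<^sub>R u" and "q = (1 - s) *\<^sub>R y + s *\<^sub>R v"
  have "F p \<le> (1 - s) * F x + s * F u" "H q \<le> (1 - s) * H y + s * H v"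
    using F_convex[OF assms(1,3,5,6)] H_convex[OF assms(2,4,5,6)] by (simp_all add: p_def q_def)
  moreover have "A p \<bullet> y' = (1 - s) * (A x \<bullet> y') + s * (A u \<bullet> y')"
    by (simp add: p_def A.add A.scaleR inner_add_left)
  moreover have "A x' \<bullet> q = (1 - s) * (A x' \<bullet> y) + s * (A x' \<bullet> v)"
    by (simp add: q_def inner_add_right)
  ultimately have "gap p q x' y' \<le> (1 - s) * gap x y x' y' + s * gap u v x' y'"
    by (simp add: gap_def algebra_simps)
  then show ?thesis by (simp only: p_def q_def)
qed

lemma convex_saddle_points: "convex (saddle_points L)"
  unfolding convex_alt
proof (intro ballI allI impI)
  fix z w and s :: real
  assume z: "z \<in> saddle_points L" and w: "w \<in> saddle_points L" and s: "0 \<le> s \<and> s \<le> 1"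
  obtain x y u v where zw: "z = (x, y)" "w = (u, v)" by (cases z; cases w)
  have fin: "f x \<noteq> \<infinity>" "h y \<noteq> \<infinity>" "f u \<noteq> \<infinity>" "h v \<noteq> \<infinity>"
    using z w unfolding zw saddle_points_iff by auto
  have "gap ((1 - s) *\<^sub>R x + s *\<^sub>R u) ((1 - s) *\<^sub>R y + s *\<^sub>R v) x' y' \<le> 0"
    if "f x' \<noteq> \<infinity>" "h y' \<noteq> \<infinity>" for x' y'
  proof -
    have "gap x y x' y' \<le> 0" "gap u v x' y' \<le> 0"
      using z w that unfolding zw saddle_points_iff by auto
    then have "(1 - s) * gap x y x' y' + s * gap u v x' y' \<le> 0"
      using s by (intro add_nonpos_nonpos mult_nonneg_nonpos) auto
    then show ?thesis using gap_convex[OF fin, of s x' y'] s by linarith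
  qed
  then show "(1 - s) *\<^sub>R z + s *\<^sub>R w \<in> saddle_points L"
    using convex_fun_finite[OF proper_f convex_f fin(1,3), of s]
      convex_fun_finite[OF proper_h convex_h fin(2,4), of s] s
    by (simp add: zw saddle_points_iff)
qed

text \<open>Finiteness of \<open>f\<close> and \<open>h\<close> at the limit is not known
  beforehand, so the gap inequality is passed to the limit with arbitrary reals \<open>p\<close>
  below \<open>f x\<close> and \<open>q\<close> below \<open>h y\<close>, and finiteness is deduced
  afterwards.\<close>

lemma closed_saddle_points: "closed (saddle_points L)"
  unfolding closed_sequential_limits
proof (intro allI impI, elim conjE)
  fix Z z assume Z: "\<forall>n. Z n \<in> saddle_points L" and lim: "Z \<longlonglongrightarrow> z"
  define X Y x y where "X n = fst (Z n)" and "Y n = snd (Z n)" and "x = fst z" and "y = snd z" for n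
  have ZXY: "(X n, Y n) \<in> saddle_points L" for n using Z by (simp add: X_def Y_def)
  have X: "X \<longlonglongrightarrow> x" and Y: "Y \<longlonglongrightarrow> y"
    unfolding X_def Y_def x_def y_def by (intro tendsto_intros lim)+
  have cont: "isCont (\<lambda>u. real_of_ereal (\<phi> u)) u" if "lipschitz_smooth K \<phi>"
    for \<phi> :: "'c::real_inner \<Rightarrow> ereal" and K u
    using lipschitz_smooth_GDERIV[OF that] unfolding gderiv_def by (rule has_derivative_continuous)
  \<comment> \<open>The inequality \<open>gap x y x' y' \<le> 0\<close> solved for
    \<open>f x + h y\<close>; the right side is continuous in \<open>x\<close> and
    \<open>y\<close>.\<close>
  let ?M = "\<lambda>x' y' x y. F x' + H y' - real_of_ereal (f2 x) - real_of_ereal (h2 y) - A x \<bullet> y' + A x' \<bullet> y"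
  have key: "p + q \<le> ?M x' y' x y"
    if "ereal p < f x" "ereal q < h y" and fin': "f x' \<noteq> \<infinity>" "h y' \<noteq> \<infinity>" for p q x' y'
  proof -
    have "\<forall>\<^sub>F u in nhds x. ereal p < f u" "\<forall>\<^sub>F v in nhds y. ereal q < h v"
      using plc_f plc_g that(1,2) by (auto simp: lsc_fun_iff_eventually proper_lsc_convex_def)
    then have "\<forall>\<^sub>F n in sequentially. ereal p < f (X n)" "\<forall>\<^sub>F n in sequentially. ereal q < h (Y n)"
      using eventually_compose_filterlim X Y by blast+
    then have "\<forall>\<^sub>F n in sequentially. p + q \<le> ?M x' y' (X n) (Y n)"
    proof eventually_elim
      case (elim n)
      have fin: "f (X n) \<noteq> \<infinity>" "h (Y n) \<noteq> \<infinity>" and "gap (X n) (Y n) x' y' \<le> 0"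
        using ZXY[of n] fin' unfolding saddle_points_iff by auto
      moreover have "p < real_of_ereal (f (X n))" "q < real_of_ereal (h (Y n))"
        using elim fin by (cases "f (X n)"; cases "h (Y n)"; simp)+
      ultimately show ?case by (simp add: gap_def F_def H_def)
    qed
    moreover have "(\<lambda>n. ?M x' y' (X n) (Y n)) \<longlonglongrightarrow> ?M x' y' x y"
      by (intro tendsto_intros X Y A.tendsto isCont_tendsto_compose[OF cont[OF smooth_f2]]
          isCont_tendsto_compose[OF cont[OF smooth_g2]])
    ultimately show ?thesis by (intro tendsto_lowerbound[OF _ _ sequentially_bot])
  qed
  have ereal_le: "e \<le> ereal r" if "\<And>p. ereal p < e \<Longrightarrow> p \<le> r" for e r
  proof (rule dense_le)
    fix c assume "c < e"
    then show "c \<le> ereal r" using that by (cases c) auto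
  qed
  obtain x0 y0 where 0: "f x0 \<noteq> \<infinity>" "h y0 \<noteq> \<infinity>"
    using proper_f proper_h by (auto simp: proper_fun_def)
  have nm: "f x \<noteq> -\<infinity>" "h y \<noteq> -\<infinity>" using proper_f proper_h by (auto simp: proper_fun_def)
  have step1: "f x \<le> ereal (?M x' y' x y - q)"
    if "ereal q < h y" "f x' \<noteq> \<infinity>" "h y' \<noteq> \<infinity>" for q x' y'
    using key[OF _ that] by (intro ereal_le) (simp add: algebra_simps)
  \<comment> \<open>One real \<open>q\<close> below \<open>h y\<close> bounds \<open>f x\<close>
    from above; once \<open>f x\<close> is a real \<open>r\<close>, letting \<open>q\<close> vary
    bounds \<open>h y\<close>.\<close>
  have "\<exists>q. ereal q < h y"
  proof (cases "h y")
    case (real r)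
    then show ?thesis by (intro exI[of _ "r - 1"]) simp
  qed (use nm in auto)
  then obtain q where "ereal q < h y" by blast
  then have x: "f x \<noteq> \<infinity>" using step1[OF _ 0] by force
  then obtain r where r: "f x = ereal r" using nm by (cases "f x") auto
  have step2: "h y \<le> ereal (?M x' y' x y - r)" if "f x' \<noteq> \<infinity>" "h y' \<noteq> \<infinity>" for x' y'
  proof (rule ereal_le)
    fix q assume "ereal q < h y"
    from step1[OF this that] show "q \<le> ?M x' y' x y - r" by (simp add: r)
  qed
  then have y: "h y \<noteq> \<infinity>" using 0 by force
  then obtain q where q: "h y = ereal q" using nm by (cases "h y") auto
  have "gap x y x' y' \<le> 0" if "f x' \<noteq> \<infinity>" "h y' \<noteq> \<infinity>" for x' y'
    using step2[OF that] by (simp add: q r gap_def F_def H_def)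
  then have "(x, y) \<in> saddle_points L" using x y by (simp add: saddle_points_iff)
  then show "z \<in> saddle_points L" by (simp add: x_def y_def)
qed

text \<open>With one component of the competitor fixed at its saddle value, the gap inequality says
  that \<open>xs\<close> minimises the primal part with linear term \<open>adjoint A ys\<close>, and
  \<open>ys\<close> the dual part with linear term \<open>- A xs\<close>.\<close>

lemma saddle_subgradient:
  assumes "(xs, ys) \<in> saddle_points L"
  shows saddle_subgradient_f: "f u \<noteq> \<infinity> \<Longrightarrow>
      real_of_ereal (f xs) - (gradient f2 xs + adjoint A ys) \<bullet> (u - xs) \<le> real_of_ereal (f u)"
    and saddle_subgradient_h: "h v \<noteq> \<infinity> \<Longrightarrow>
      real_of_ereal (h ys) - (gradient h2 ys + - A xs) \<bullet> (v - ys) \<le> real_of_ereal (h v)"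
proof -
  have fin: "f xs \<noteq> \<infinity>" "h ys \<noteq> \<infinity>"
    and gap: "\<And>x' y'. f x' \<noteq> \<infinity> \<Longrightarrow> h y' \<noteq> \<infinity> \<Longrightarrow> gap xs ys x' y' \<le> 0"
    using assms unfolding saddle_points_iff by auto
  have adj: "adjoint A ys \<bullet> u = A u \<bullet> ys" for u
    using inner_adjoint[OF bounded_linear_A, of u ys] by (simp add: inner_commute)
  show "real_of_ereal (f xs) - (gradient f2 xs + adjoint A ys) \<bullet> (u - xs) \<le> real_of_ereal (f u)"
    if "f u \<noteq> \<infinity>"
  proof (rule composite_minimizer_subgradient[OF proper_f convex_f smooth_f2 fin(1) that])
    fix w assume "f w \<noteq> \<infinity>"
    from gap[OF this fin(2)] show "real_of_ereal (f xs) + real_of_ereal (f2 xs) + adjoint A ys \<bullet> xs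
        \<le> real_of_ereal (f w) + real_of_ereal (f2 w) + adjoint A ys \<bullet> w"
      by (simp add: gap_def F_def adj)
  qed
  show "real_of_ereal (h ys) - (gradient h2 ys + - A xs) \<bullet> (v - ys) \<le> real_of_ereal (h v)"
    if "h v \<noteq> \<infinity>"
  proof (rule composite_minimizer_subgradient[OF proper_h convex_h smooth_g2 fin(2) that])
    fix w assume "h w \<noteq> \<infinity>"
    from gap[OF fin(1) this] show "real_of_ereal (h ys) + real_of_ereal (h2 ys) + - A xs \<bullet> ys
        \<le> real_of_ereal (h w) + real_of_ereal (h2 w) + - A xs \<bullet> w"
      by (simp add: gap_def H_def)
  qed
qed

end

subsection \<open>Scalar inequalities\<close>

text \<open>The product condition makes \<open>l\<close> an eigenvalue of the symmetric matrix with
  diagonal \<open>p\<close>, \<open>q\<close> and off-diagonal entry \<open>- p * g\<close>, so the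
  form minus \<open>l * (u\<^sup>2 + v\<^sup>2)\<close> is the perfect square
  \<open>(a * u - b * v)\<^sup>2\<close>.\<close>

lemma quadratic_form_ge:
  fixes p q l g u v :: real
  assumes "p \<ge> l" "q \<ge> l" "(p - l) * (q - l) = (p * g)\<^sup>2" "p \<ge> 0" "g \<ge> 0"
  shows "l * (u\<^sup>2 + v\<^sup>2) \<le> p * u\<^sup>2 - 2 * (p * g * (u * v)) + q * v\<^sup>2"
proof -
  define a b where "a = sqrt (p - l)" and "b = sqrt (q - l)"
  have ab: "a\<^sup>2 = p - l" "b\<^sup>2 = q - l" using assms by (auto simp: a_def b_def)
  have "a * b = p * g"
    using assms(3-5) by (simp add: a_def b_def real_sqrt_mult[symmetric])
  moreover have "0 \<le> (a * u - b * v)\<^sup>2" by simp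
  then have "0 \<le> a\<^sup>2 * u\<^sup>2 - 2 * ((a * b) * (u * v)) + b\<^sup>2 * v\<^sup>2"
    by (simp add: power2_diff power_mult_distrib algebra_simps)
  ultimately show ?thesis unfolding ab by (simp add: algebra_simps)
qed

section \<open>The constant \<open>lam\<close> as an eigenvalue\<close>

definition pdhg_lam :: "real \<Rightarrow> real \<Rightarrow> real \<Rightarrow> real" where
  "pdhg_lam \<alpha>f \<alpha>g \<gamma> = 1 - \<alpha>f - (\<alpha>g - (1 - \<gamma>) * \<alpha>f) / 2
     - sqrt ((1 - \<alpha>f)\<^sup>2 * \<gamma> + ((1 - \<gamma>) * \<alpha>f - \<alpha>g)\<^sup>2 / 4)"

text \<open>In these variables the constant is the smaller eigenvalue of the matrix with diagonal
  \<open>p\<close>, \<open>q\<close> and off-diagonal entry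
  \<open>- p * sqrt \<gamma>\<close>.\<close>

lemma pdhg_lam_eq:
  assumes p: "p = 1 - \<alpha>f" and q: "q = 1 - \<alpha>g - \<gamma> * \<alpha>f"
  shows "pdhg_lam \<alpha>f \<alpha>g \<gamma> = (p + q) / 2 - sqrt (p\<^sup>2 * \<gamma> + ((p - q) / 2)\<^sup>2)"
proof -
  have 1: "\<alpha>g - (1 - \<gamma>) * \<alpha>f = p - q" "(1 - \<gamma>) * \<alpha>f - \<alpha>g = - (p - q)"
    by (simp_all add: p q algebra_simps)
  have "pdhg_lam \<alpha>f \<alpha>g \<gamma> = p - (p - q) / 2 - sqrt (p\<^sup>2 * \<gamma> + (p - q)\<^sup>2 / 4)"
    unfolding pdhg_lam_def 1 p[symmetric] power2_minus ..
  then show ?thesis by (simp add: power_divide field_simps)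
qed

text \<open>Both diagonal entries and the determinant \<open>p * (q - p * \<gamma>)\<close> are
  positive; \<open>p * \<gamma> < q\<close> is the condition \<open>\<alpha>g + \<gamma> < 1\<close>
  in disguise.\<close>

lemma pdhg_lam_pos:
  assumes "\<gamma> \<ge> 0" "\<alpha>f < 1" "\<alpha>g + \<gamma> < 1"
  shows "pdhg_lam \<alpha>f \<alpha>g \<gamma> > 0"
proof -
  define p q where "p = 1 - \<alpha>f" and "q = 1 - \<alpha>g - \<gamma> * \<alpha>f"
  have p: "p > 0" using assms by (simp add: p_def)
  have pq: "p * \<gamma> < q" using assms by (simp add: p_def q_def algebra_simps)
  moreover have "0 \<le> p * \<gamma>" using p assms by simp
  ultimately have q: "q > 0" by linarith
  have "p * (p * \<gamma>) < p * q" by (rule mult_strict_left_mono[OF pq p])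
  moreover have "((p + q) / 2)\<^sup>2 = ((p - q) / 2)\<^sup>2 + p * q" "p\<^sup>2 * \<gamma> = p * (p * \<gamma>)"
    by (simp_all add: power2_eq_square field_simps)
  ultimately have "p\<^sup>2 * \<gamma> + ((p - q) / 2)\<^sup>2 < ((p + q) / 2)\<^sup>2" by (simp only:)
  then have "sqrt (p\<^sup>2 * \<gamma> + ((p - q) / 2)\<^sup>2) < (p + q) / 2"
    by (rule real_less_lsqrt[rotated]) (use p q in simp)
  then show ?thesis unfolding pdhg_lam_eq[OF p_def q_def] by simp
qed

text \<open>Here \<open>d\<close> is the primal displacement and \<open>e\<close> is
  \<open>adjoint A\<close> applied to the dual one, so the right side is \<open>W\<close>.
  Cauchy-Schwarz reduces the estimate to a quadratic form in two real variables.\<close>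

lemma pdhg_lam_le:
  fixes d e :: "'a::real_inner"
  assumes "\<tau> > 0" "\<gamma> \<ge> 0" "0 \<le> \<alpha>f" "\<alpha>f < 1" "\<tau> * (norm e)\<^sup>2 \<le> \<gamma> * Y" "Y \<ge> 0"
  shows "pdhg_lam \<alpha>f \<alpha>g \<gamma> * (1 / \<tau> * (norm d)\<^sup>2 + Y)
    \<le> (1 - \<alpha>f) * (1 / \<tau> * (norm (d + \<tau> *\<^sub>R e))\<^sup>2) + (1 - \<alpha>g) * Y - \<tau> * (norm e)\<^sup>2"
proof -
  define p q m R where "p = 1 - \<alpha>f" and "q = 1 - \<alpha>g - \<gamma> * \<alpha>f" and "m = (p - q) / 2"
    and "R = sqrt (p\<^sup>2 * \<gamma> + m\<^sup>2)"
  define u v g where "u = norm d / sqrt \<tau>" and "v = sqrt Y" and "g = sqrt \<gamma>"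
  define s where "s = sqrt \<tau> * norm e"
  have p: "p > 0" using assms by (simp add: p_def)
  have lam: "pdhg_lam \<alpha>f \<alpha>g \<gamma> = (p + q) / 2 - R"
    unfolding R_def m_def by (rule pdhg_lam_eq[OF p_def q_def])
  have R2: "R\<^sup>2 = p\<^sup>2 * \<gamma> + m\<^sup>2" using assms by (simp add: R_def)
  have "\<bar>m\<bar> \<le> R" unfolding R_def using assms by (intro real_le_rsqrt) simp
  then have mR: "m + R \<ge> 0" "R - m \<ge> 0" by auto
  have eq: "p - ((p + q) / 2 - R) = R + m" "q - ((p + q) / 2 - R) = R - m"
    by (simp_all add: m_def field_simps)
  have "(R + m) * (R - m) = R\<^sup>2 - m\<^sup>2" by (simp add: power2_eq_square algebra_simps)
  also have "\<dots> = (p * g)\<^sup>2" using assms(2) by (simp add: R2 g_def power_mult_distrib)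
  finally have Rm: "(p - ((p + q) / 2 - R)) * (q - ((p + q) / 2 - R)) = (p * g)\<^sup>2" by (simp only: eq)
  have "(p + q) / 2 - R \<le> p" "(p + q) / 2 - R \<le> q" using eq mR by linarith+
  from quadratic_form_ge[OF this Rm] p
  have quad: "pdhg_lam \<alpha>f \<alpha>g \<gamma> * (u\<^sup>2 + v\<^sup>2) \<le> p * u\<^sup>2 - 2 * (p * g * (u * v)) + q * v\<^sup>2"
    unfolding lam using assms(2) by (simp add: g_def)
  have u2: "u\<^sup>2 = 1 / \<tau> * (norm d)\<^sup>2" and v2: "v\<^sup>2 = Y" and s2: "s\<^sup>2 = \<tau> * (norm e)\<^sup>2"
    using assms by (simp_all add: u_def v_def s_def power_divide power_mult_distrib)
  have nonneg: "u \<ge> 0" "s \<ge> 0" "g \<ge> 0" "v \<ge> 0" using assms by (auto simp: u_def s_def g_def v_def)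
  have "s \<le> g * v"
    using assms s2 unfolding g_def v_def real_sqrt_mult[symmetric] by (intro real_le_rsqrt) simp
  then have us: "p * (u * s) \<le> p * (u * (g * v))"
    by (intro mult_left_mono nonneg less_imp_le[OF p])
  have ude: "u * s = norm d * norm e" using assms by (simp add: u_def s_def)
  have cs: "- (d \<bullet> e) \<le> norm d * norm e"
    using norm_cauchy_schwarz[of "- d" e] by simp
  have expand: "1 / \<tau> * (norm (d + \<tau> *\<^sub>R e))\<^sup>2 = 1 / \<tau> * (norm d)\<^sup>2 + 2 * (d \<bullet> e) + \<tau> * (norm e)\<^sup>2"
  proof -
    have "(norm (d + \<tau> *\<^sub>R e))\<^sup>2 = (norm d)\<^sup>2 + \<tau> * (2 * (d \<bullet> e) + \<tau> * (norm e)\<^sup>2)"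
      unfolding power2_norm_eq_inner
      by (simp add: inner_add_left inner_add_right inner_commute[of e d] distrib_left)
    then show ?thesis using assms(1) by (simp add: add_divide_distrib)
  qed
  have "u\<^sup>2 - 2 * (u * s) + s\<^sup>2 \<le> 1 / \<tau> * (norm (d + \<tau> *\<^sub>R e))\<^sup>2"
    unfolding u2 s2 ude expand using cs by simp
  then have "p * (u\<^sup>2 - 2 * (u * s) + s\<^sup>2) \<le> p * (1 / \<tau> * (norm (d + \<tau> *\<^sub>R e))\<^sup>2)"
    using p by (intro mult_left_mono) auto
  \<comment> \<open>The squares of \<open>s\<close> combine to
    \<open>- \<alpha>f * s\<^sup>2\<close>; bounding this by \<open>Y\<close> produces the term
    \<open>\<gamma> * \<alpha>f\<close> in \<open>q\<close>.\<close>
  moreover have "\<alpha>f * s\<^sup>2 \<le> \<alpha>f * (\<gamma> * Y)" using assms s2 by (intro mult_left_mono) auto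
  moreover have "p * s\<^sup>2 - s\<^sup>2 = - (\<alpha>f * s\<^sup>2)" "q * Y = (1 - \<alpha>g) * Y - \<alpha>f * (\<gamma> * Y)"
    by (simp_all add: p_def q_def algebra_simps)
  moreover have "p * (u\<^sup>2 - 2 * (u * s) + s\<^sup>2) = p * u\<^sup>2 - 2 * (p * (u * s)) + p * s\<^sup>2"
    "p * g * (u * v) = p * (u * (g * v))" by (simp_all add: algebra_simps)
  ultimately show ?thesis
    using quad us unfolding v2 u2[symmetric] s2[symmetric] p_def[symmetric] by linarith
qed

section \<open>The constant \<open>a2\<close> and the scalar steps behind the rate\<close>

definition pdhg_a2 :: "real \<Rightarrow> real \<Rightarrow> real \<Rightarrow> real" where
  "pdhg_a2 \<alpha>f \<alpha>g \<gamma> = max ((2 * \<alpha>f - 1) / (1 - \<alpha>f)) ((2 * \<alpha>g - 1 + \<gamma>) / (1 - \<alpha>g - \<gamma>))"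

lemma pdhg_a2_ge:
  assumes "0 \<le> \<alpha>f" "\<alpha>f < 1"
  shows "- 1 \<le> pdhg_a2 \<alpha>f \<alpha>g \<gamma>"
proof -
  have "- 1 \<le> (2 * \<alpha>f - 1) / (1 - \<alpha>f)" using assms by (simp add: pos_le_divide_eq)
  then show ?thesis by (simp add: pdhg_a2_def)
qed

text \<open>The entries of the maximum are the ratios of the coefficients of \<open>P\<close> and of
  \<open>Y\<close> once \<open>S\<close> is replaced by \<open>\<gamma> * Y\<close>;
  \<open>1 + a2 \<ge> 0\<close> permits this replacement.\<close>

lemma pdhg_a2_le:
  assumes "0 \<le> \<alpha>f" "\<alpha>f < 1" "\<alpha>g + \<gamma> < 1" "0 \<le> P" "0 \<le> Y" "S \<le> \<gamma> * Y"
  shows "(2 * \<alpha>f - 1) * P + (2 * \<alpha>g - 1) * Y + S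
    \<le> pdhg_a2 \<alpha>f \<alpha>g \<gamma> * ((1 - \<alpha>f) * P + (1 - \<alpha>g) * Y - S)"
proof -
  let ?a = "pdhg_a2 \<alpha>f \<alpha>g \<gamma>"
  have "(2 * \<alpha>f - 1) / (1 - \<alpha>f) \<le> ?a" "(2 * \<alpha>g - 1 + \<gamma>) / (1 - \<alpha>g - \<gamma>) \<le> ?a"
    by (simp_all add: pdhg_a2_def)
  then have "2 * \<alpha>f - 1 \<le> ?a * (1 - \<alpha>f)" "2 * \<alpha>g - 1 + \<gamma> \<le> ?a * (1 - \<alpha>g - \<gamma>)"
    using assms by (simp_all add: pos_divide_le_eq)
  then have "(2 * \<alpha>f - 1) * P \<le> ?a * (1 - \<alpha>f) * P" "(2 * \<alpha>g - 1 + \<gamma>) * Y \<le> ?a * (1 - \<alpha>g - \<gamma>) * Y"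
    using assms by (intro mult_right_mono; simp)+
  moreover have "(1 + ?a) * S \<le> (1 + ?a) * (\<gamma> * Y)"
    using pdhg_a2_ge[OF assms(1,2), of \<alpha>g \<gamma>] assms by (intro mult_left_mono) auto
  ultimately show ?thesis by (simp add: algebra_simps)
qed

text \<open>Cauchy-Schwarz with weights \<open>\<eta>\<close> and \<open>l\<close>: the constant
  equals \<open>\<eta> * l / (l + \<eta>)\<close>, and after multiplication by
  \<open>l + \<eta>\<close> the defect for \<open>d = w + n\<close> is the square
  \<open>(\<eta> * w - l * n)\<^sup>2\<close>.\<close>

lemma weighted_square_sum:
  fixes d w n \<eta> l :: real
  assumes "0 \<le> d" "0 \<le> w" "d \<le> w + n" "0 < \<eta>" "0 < l"
  shows "\<eta> / (1 + \<eta> / l) * d\<^sup>2 \<le> \<eta> * w\<^sup>2 + l * n\<^sup>2"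
proof -
  have pos: "l + \<eta> > 0" using assms by simp
  have eq: "\<eta> / (1 + \<eta> / l) = \<eta> * l / (l + \<eta>)" using assms by (simp add: field_simps)
  have "\<eta> * l * d\<^sup>2 \<le> \<eta> * l * (w + n)\<^sup>2" using assms by (intro mult_left_mono power_mono) auto
  also have "\<dots> \<le> \<eta> * l * (w + n)\<^sup>2 + (\<eta> * w - l * n)\<^sup>2" by simp
  also have "\<dots> = (l + \<eta>) * (\<eta> * w\<^sup>2 + l * n\<^sup>2)"
    by (simp add: power2_eq_square algebra_simps)
  finally have "\<eta> * l * d\<^sup>2 \<le> (l + \<eta>) * (\<eta> * w\<^sup>2 + l * n\<^sup>2)" .
  then show ?thesis unfolding eq using pos by (simp add: field_simps)
qed

text \<open>The sign of \<open>a\<close> decides whether \<open>W \<le> \<Delta>\<close> or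
  \<open>l * (X + Y) \<le> W\<close> bounds \<open>a * W\<close>. In both cases \<open>m\<close> is
  the share of the maximum left for \<open>X\<close> and \<open>Y\<close>, converted by
  \<open>l * (X + Y) \<le> \<Delta>\<close>.\<close>

lemma rate_bound:
  fixes a l bx by' \<Delta> W X Y :: real
  assumes "0 < l" "- 1 \<le> a" "0 \<le> bx" "0 \<le> by'" "0 \<le> X" "0 \<le> Y" "W \<le> \<Delta>" "l * (X + Y) \<le> W"
  shows "l * (\<Delta> + a * W + bx * X + (by' + l) * Y) \<le> max ((1 + a) * l + bx) ((2 + a) * l + by') * \<Delta>"
proof -
  define M where "M = max ((1 + a) * l + bx) ((2 + a) * l + by')"
  have "0 \<le> l * (X + Y)" using assms by simp
  then have \<Delta>: "0 \<le> \<Delta>" "l * (X + Y) \<le> \<Delta>" using assms by linarith+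
  show ?thesis
  proof (cases "a \<ge> 0")
    case True
    define m where "m = M - (1 + a) * l"
    have m: "bx \<le> m" "by' + l \<le> m" by (simp_all add: m_def M_def algebra_simps)
    have "a * W \<le> a * \<Delta>" using True assms by (intro mult_left_mono)
    moreover have "bx * X \<le> m * X" "(by' + l) * Y \<le> m * Y" using m assms by (intro mult_right_mono; simp)+
    ultimately have "\<Delta> + a * W + bx * X + (by' + l) * Y \<le> (1 + a) * \<Delta> + m * (X + Y)"
      by (simp add: algebra_simps)
    then have "l * (\<Delta> + a * W + bx * X + (by' + l) * Y) \<le> l * ((1 + a) * \<Delta> + m * (X + Y))"
      using assms by (intro mult_left_mono) auto
    also have "\<dots> = (1 + a) * l * \<Delta> + m * (l * (X + Y))" by (simp add: algebra_simps)
    also have "\<dots> \<le> (1 + a) * l * \<Delta> + m * \<Delta>" using \<Delta> m assms by (intro add_left_mono mult_left_mono) auto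
    also have "\<dots> = M * \<Delta>" by (simp add: m_def algebra_simps)
    finally show ?thesis by (simp add: M_def)
  next
    case False
    define m where "m = M - l"
    have m: "a * l + bx \<le> m" "a * l + by' + l \<le> m" by (simp_all add: m_def M_def algebra_simps)
    have "0 \<le> (1 + a) * l" using assms by simp
    then have "0 \<le> a * l + by' + l" using assms(4) by (simp add: algebra_simps)
    with m have m0: "0 \<le> m" by linarith
    have "a * W \<le> a * (l * (X + Y))" using False assms by (intro mult_left_mono_neg) auto
    moreover have "(a * l + bx) * X \<le> m * X" "(a * l + by' + l) * Y \<le> m * Y"
      using m assms by (intro mult_right_mono; simp)+
    ultimately have "\<Delta> + a * W + bx * X + (by' + l) * Y \<le> \<Delta> + m * (X + Y)"
      by (simp add: algebra_simps)
    then have "l * (\<Delta> + a * W + bx * X + (by' + l) * Y) \<le> l * (\<Delta> + m * (X + Y))"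
      using assms by (intro mult_left_mono) auto
    also have "\<dots> = l * \<Delta> + m * (l * (X + Y))" by (simp add: algebra_simps)
    also have "\<dots> \<le> l * \<Delta> + m * \<Delta>" using \<Delta> m0 by (intro add_left_mono mult_left_mono) auto
    also have "\<dots> = M * \<Delta>" by (simp add: m_def algebra_simps)
    finally show ?thesis by (simp add: M_def)
  qed
qed

text \<open>Completing the square \<open>(b * norm d - norm v)\<^sup>2\<close> trades the linear
  term for the penalty and \<open>1 / b\<close> times the square of \<open>v\<close>. For
  \<open>\<beta> = \<infinity>\<close> the direction \<open>d\<close> vanishes,
  \<open>\<infinity> * 0 = 0\<close> gives \<open>q = 0\<close>, and \<open>1 / \<beta>\<close> is
  0.\<close>

lemma penalty_absorbs_linear:
  fixes v d :: "'a::real_inner"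
  assumes "0 < \<beta>" "\<beta> = \<infinity> \<Longrightarrow> d = 0" "0 \<le> t" "t \<le> 1" "\<tau> > 0"
  shows "\<exists>q. \<beta> * ereal ((norm d)\<^sup>2 / (2 * \<tau>)) = ereal q \<and>
    2 * (t * (1 / \<tau> * (v \<bullet> d))) - 2 * q \<le> real_of_ereal (1 / \<beta>) * (1 / \<tau> * (norm v)\<^sup>2)"
proof (cases "\<beta> = \<infinity>")
  case True
  then show ?thesis using assms by (intro exI[of _ 0]) (simp add: zero_ereal_def)
next
  case False
  then obtain b where b: "\<beta> = ereal b" "b > 0" using assms(1) by (cases \<beta>) auto
  have "t * (v \<bullet> d) \<le> norm v * norm d"
  proof -
    have "t * (v \<bullet> d) \<le> \<bar>t\<bar> * \<bar>v \<bullet> d\<bar>" by (metis abs_ge_self abs_mult)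
    also have "\<dots> \<le> 1 * (norm v * norm d)"
      using assms Cauchy_Schwarz_ineq2[of v d] by (intro mult_mono) auto
    finally show ?thesis by simp
  qed
  moreover have "0 \<le> (b * norm d - norm v)\<^sup>2 / b" using b by simp
  moreover have "(b * norm d - norm v)\<^sup>2 / b = b * (norm d)\<^sup>2 - 2 * (norm v * norm d) + (norm v)\<^sup>2 / b"
    using b by (simp add: power2_eq_square field_simps)
  ultimately have "2 * (t * (v \<bullet> d)) - b * (norm d)\<^sup>2 \<le> (norm v)\<^sup>2 / b" by linarith
  then have "1 / \<tau> * (2 * (t * (v \<bullet> d)) - b * (norm d)\<^sup>2) \<le> 1 / \<tau> * ((norm v)\<^sup>2 / b)"
    using assms by (intro mult_left_mono) auto
  then show ?thesis using b assms(5)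
    by (intro exI[of _ "b * ((norm d)\<^sup>2 / (2 * \<tau>))"]) (simp add: one_ereal_def right_diff_distrib ac_simps)
qed

text \<open>Meant for the gap \<open>u\<close> at the saddle point \<open>c\<close> and the gap
  \<open>v\<close> at the intermediate point. Multiplying by \<open>t\<close> can only shrink
  \<open>D\<close>, as it is nonnegative, and the penalties take care of
  \<open>t * l\<close>.\<close>

lemma convex_combination_gap_bound:
  fixes t D l B x u v qx qy :: real
  assumes "x \<le> (1 - t) * u + t * v" "u \<le> 0" "2 * v \<le> D + 2 * l" "0 \<le> D" "0 \<le> t" "t \<le> 1"
    and "2 * (t * l) - 2 * qx - 2 * qy \<le> B"
  shows "2 * (x - qx - qy) \<le> D + B"
proof -
  have "(1 - t) * u \<le> 0" using assms by (intro mult_nonneg_nonpos) auto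
  moreover have "t * (2 * v) \<le> t * (D + 2 * l)" using assms by (intro mult_left_mono) auto
  then have "2 * (t * v) \<le> t * D + 2 * (t * l)" by (simp add: algebra_simps)
  moreover have "t * D \<le> D" using assms by (intro mult_left_le_one_le) auto
  ultimately show ?thesis using assms(1,7) by argo
qed

subsection \<open>Estimates for one PDHG step\<close>

locale pdhg_problem = saddle_problem +
  fixes \<tau> \<sigma> \<gamma> \<alpha>f \<alpha>g :: real
  assumes \<tau>: "\<tau> > 0" and \<sigma>: "\<sigma> > 0"
    and \<gamma>: "\<gamma> = \<sigma> * \<tau> * (onorm A)\<^sup>2" and \<alpha>f: "\<alpha>f = \<tau> * Lf / 2" and \<alpha>g: "\<alpha>g = \<sigma> * Lg / 2"
    and \<gamma>_less: "\<gamma> < 1" and \<alpha>f_less: "\<alpha>f < 1" and \<alpha>g_less: "\<alpha>g + \<gamma> < 1"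
begin

interpretation A: bounded_linear A by (rule bounded_linear_A)

abbreviation "N \<equiv> norm_V \<tau> \<sigma>"
abbreviation "T \<equiv> pdhg_step A f f2 g g2 \<tau> \<sigma>"
abbreviation "lam \<equiv> pdhg_lam \<alpha>f \<alpha>g \<gamma>"
abbreviation "a2 \<equiv> pdhg_a2 \<alpha>f \<alpha>g \<gamma>"

definition "xbar z = prox (\<lambda>u. ereal \<tau> * f u)
  (fst z - \<tau> *\<^sub>R gradient f2 (fst z) - \<tau> *\<^sub>R adjoint A (snd z))"
text \<open>The linear term is written as \<open>- A (xbar z)\<close> so that one proximal gradient
  lemma covers both updates.\<close>

definition "ybar z = prox (\<lambda>v. ereal \<sigma> * h v)
  (snd z - \<sigma> *\<^sub>R gradient h2 (snd z) - \<sigma> *\<^sub>R (- A (xbar z)))"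

lemma T_eq: "T z = (xbar z - \<tau> *\<^sub>R adjoint A (ybar z - snd z), ybar z)"
  by (simp only: pdhg_step_def Let_def xbar_def ybar_def scaleR_minus_right diff_minus_eq_add)

text \<open>\<open>X\<close> and \<open>Y\<close> are the primal and dual parts of the squared step
  from \<open>z\<close> to \<open>T z\<close>; \<open>P\<close> is the squared move to the
  uncorrected primal point and \<open>S\<close> the squared correction.\<close>

definition "X z = 1 / \<tau> * (norm (fst (T z) - fst z))\<^sup>2"
definition "Y z = 1 / \<sigma> * (norm (ybar z - snd z))\<^sup>2"
definition "P z = 1 / \<tau> * (norm (xbar z - fst z))\<^sup>2"
definition "S z = \<tau> * (norm (adjoint A (ybar z - snd z)))\<^sup>2"
definition "W z = (1 - \<alpha>f) * P z + (1 - \<alpha>g) * Y z - S z"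

lemma nonneg: "0 \<le> \<alpha>f" "0 \<le> \<gamma>" "0 \<le> X z" "0 \<le> Y z" "0 \<le> P z"
proof -
  have "0 \<le> Lf" using smooth_f2 by (auto simp: lipschitz_smooth_def dest: lipschitz_on_nonneg)
  then show "0 \<le> \<alpha>f" "0 \<le> \<gamma>" "0 \<le> X z" "0 \<le> Y z" "0 \<le> P z"
    using \<tau> \<sigma> by (auto simp: \<alpha>f \<gamma> X_def Y_def P_def)
qed

lemma S_le: "S z \<le> \<gamma> * Y z"
proof -
  have "(norm (adjoint A (ybar z - snd z)))\<^sup>2 \<le> (onorm A * norm (ybar z - snd z))\<^sup>2"
    by (intro power_mono norm_adjoint_le bounded_linear_A) auto
  then have "S z \<le> \<tau> * (onorm A * norm (ybar z - snd z))\<^sup>2"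
    unfolding S_def using \<tau> by (intro mult_left_mono) auto
  also have "\<dots> = \<gamma> * Y z" using \<sigma> by (simp add: \<gamma> Y_def power_mult_distrib)
  finally show ?thesis .
qed

lemma lam_pos: "lam > 0"
  using pdhg_lam_pos nonneg(2) \<alpha>f_less \<alpha>g_less by blast

lemma lam_le: "lam * (X z + Y z) \<le> W z"
proof -
  have eq: "xbar z - fst z = (fst (T z) - fst z) + \<tau> *\<^sub>R adjoint A (ybar z - snd z)"
    by (simp add: T_eq)
  then show ?thesis
    using pdhg_lam_le[OF \<tau> nonneg(2,1) \<alpha>f_less, of "adjoint A (ybar z - snd z)" "Y z" "\<alpha>g" "fst (T z) - fst z"]
      S_le[of z] nonneg(4)[of z]
    unfolding W_def P_def X_def S_def eq by simp
qed

lemma W_nonneg: "0 \<le> W z"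
proof -
  have "0 \<le> lam * (X z + Y z)" using lam_pos nonneg(3,4)[of z] by simp
  then show ?thesis using lam_le[of z] by linarith
qed

lemma adjoint_inner: "adjoint A y \<bullet> v = A v \<bullet> y"
  using inner_adjoint[OF bounded_linear_A, of v y] by (simp add: inner_commute)

text \<open>The primal step uses the old dual variable, the gap the new one. The correction in
  \<open>T\<close> makes up for exactly this mismatch, so that afterwards all coupling terms
  cancel.\<close>

lemma inner_step_shift:
  "1 / \<tau> * ((fst z - xbar z) \<bullet> v) = 1 / \<tau> * ((fst z - fst (T z)) \<bullet> v) - A v \<bullet> (ybar z - snd z)"
proof -
  have eq: "fst z - fst (T z) = (fst z - xbar z) + \<tau> *\<^sub>R adjoint A (ybar z - snd z)"
    by (simp add: T_eq)
  have "(fst z - fst (T z)) \<bullet> v = (fst z - xbar z) \<bullet> v + \<tau> * (A v \<bullet> (ybar z - snd z))"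
    by (simp only: eq inner_add_left inner_scaleR_left adjoint_inner)
  then show ?thesis using \<tau> by (simp add: field_simps)
qed

lemma four_point_step:
  "2 * (1 / \<tau> * ((fst z - fst (T z)) \<bullet> (xbar z - x)) + 1 / \<sigma> * ((snd z - ybar z) \<bullet> (ybar z - y)))
    = (N (z - (x, y)))\<^sup>2 - (N (T z - (x, y)))\<^sup>2 - P z - Y z + S z"
proof -
  have "1 / \<tau> * (norm (fst (T z) - xbar z))\<^sup>2 = S z"
    using \<tau> by (simp add: T_eq S_def power_mult_distrib power2_eq_square)
  moreover have "2 * (1 / \<tau> * ((fst z - fst (T z)) \<bullet> (xbar z - x)))
    = 1 / \<tau> * (norm (fst z - x))\<^sup>2 - 1 / \<tau> * (norm (fst (T z) - x))\<^sup>2 - P z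
      + 1 / \<tau> * (norm (fst (T z) - xbar z))\<^sup>2"
    using arg_cong[OF four_point_identity[of "fst z" "fst (T z)" "xbar z" x], of "\<lambda>r. 1 / \<tau> * r"]
    unfolding P_def by (simp only: right_diff_distrib distrib_left mult.left_commute)
  moreover have "2 * (1 / \<sigma> * ((snd z - ybar z) \<bullet> (ybar z - y)))
    = 1 / \<sigma> * (norm (snd z - y))\<^sup>2 - 1 / \<sigma> * (norm (ybar z - y))\<^sup>2 - Y z"
    using arg_cong[OF four_point_identity[of "snd z" "ybar z" "ybar z" y], of "\<lambda>r. 1 / \<sigma> * r"]
    unfolding Y_def by (simp add: right_diff_distrib distrib_left diff_divide_distrib)
  moreover have "snd (T z) = ybar z" by (simp add: T_eq)
  ultimately show ?thesis by (simp add: norm_V_power2[OF \<tau> \<sigma>])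
qed

lemma smooth_terms:
  "Lf * (norm (xbar z - fst z))\<^sup>2 = 2 * \<alpha>f * P z" "Lg * (norm (ybar z - snd z))\<^sup>2 = 2 * \<alpha>g * Y z"
  using \<tau> \<sigma> by (simp_all add: \<alpha>f \<alpha>g P_def Y_def)

lemma bar_finite: "f (xbar z) \<noteq> \<infinity>" "h (ybar z) \<noteq> \<infinity>"
  using prox_gradient_step_finite[OF plc_f convex_f2 smooth_f2 \<tau> xbar_def]
    prox_gradient_step_finite[OF plc_g convex_g2 smooth_g2 \<sigma> ybar_def] by auto

text \<open>The inequalities of the step and of the saddle point are added, the coupling cancels,
  and the four-point identity turns inner products into squares. The losses of \<open>L / 4\<close>
  become \<open>\<alpha>f * P\<close> and \<open>\<alpha>g * Y\<close>, which leaves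
  \<open>W\<close>.\<close>

lemma fejer_step:
  assumes "s \<in> saddle_points L"
  shows "(N (T z - s))\<^sup>2 + W z \<le> (N (z - s))\<^sup>2"
proof -
  obtain xs ys where s: "s = (xs, ys)" by (cases s)
  have fin: "f xs \<noteq> \<infinity>" "h ys \<noteq> \<infinity>" using assms unfolding s saddle_points_iff by auto
  have 1: "- (Lf / 4 * (norm (xbar z - fst z))\<^sup>2) \<le> 1 / \<tau> * ((fst z - xbar z) \<bullet> (xbar z - xs))
      - adjoint A (snd z) \<bullet> (xbar z - xs) + adjoint A ys \<bullet> (xbar z - xs)"
    using saddle_subgradient_f[OF assms[unfolded s]]
    by (rule prox_gradient_step_monotone[OF plc_f convex_f2 smooth_f2 \<tau> xbar_def fin(1)])
  have 2: "- (Lg / 4 * (norm (ybar z - snd z))\<^sup>2) \<le> 1 / \<sigma> * ((snd z - ybar z) \<bullet> (ybar z - ys))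
      - (- A (xbar z)) \<bullet> (ybar z - ys) + (- A xs) \<bullet> (ybar z - ys)"
    using saddle_subgradient_h[OF assms[unfolded s]]
    by (rule prox_gradient_step_monotone[OF plc_g convex_g2 smooth_g2 \<sigma> ybar_def fin(2)])
  have "- (Lf / 4 * (norm (xbar z - fst z))\<^sup>2) - Lg / 4 * (norm (ybar z - snd z))\<^sup>2
    \<le> 1 / \<tau> * ((fst z - fst (T z)) \<bullet> (xbar z - xs)) + 1 / \<sigma> * ((snd z - ybar z) \<bullet> (ybar z - ys))"
    using 1 2 unfolding inner_step_shift adjoint_inner
    by (simp add: A.diff inner_diff_left inner_diff_right)
  then show ?thesis
    using four_point_step[of z xs ys] smooth_terms[of z] unfolding s W_def
    by (simp add: algebra_simps)
qed

text \<open>The coupling cancels as in \<open>fejer_step\<close>, but against an arbitrary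
  competitor the descent lemma loses twice as much. The remainder may be positive, and
  \<open>a2\<close> is the factor that bounds it by \<open>W\<close>.\<close>

lemma gap_step:
  assumes x: "f x \<noteq> \<infinity>" and y: "h y \<noteq> \<infinity>"
  shows "2 * gap (xbar z) (ybar z) x y \<le> (N (z - (x, y)))\<^sup>2 - (N (T z - (x, y)))\<^sup>2 + a2 * W z"
proof -
  have neg: "a \<bullet> (x - xbar z) = - (a \<bullet> (xbar z - x))" "b \<bullet> (y - ybar z) = - (b \<bullet> (ybar z - y))" for a b
    by (simp_all add: inner_diff_right)
  have 1: "F (xbar z) + 1 / \<tau> * ((fst z - xbar z) \<bullet> (x - xbar z)) - adjoint A (snd z) \<bullet> (x - xbar z)
      - Lf / 2 * (norm (xbar z - fst z))\<^sup>2 \<le> F x"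
    using prox_gradient_step_le[OF plc_f convex_f2 smooth_f2 \<tau> xbar_def x] by (simp add: F_def)
  have 2: "H (ybar z) + 1 / \<sigma> * ((snd z - ybar z) \<bullet> (y - ybar z)) - (- A (xbar z)) \<bullet> (y - ybar z)
      - Lg / 2 * (norm (ybar z - snd z))\<^sup>2 \<le> H y"
    using prox_gradient_step_le[OF plc_g convex_g2 smooth_g2 \<sigma> ybar_def y] by (simp add: H_def)
  have "gap (xbar z) (ybar z) x y \<le> 1 / \<tau> * ((fst z - fst (T z)) \<bullet> (xbar z - x))
      + 1 / \<sigma> * ((snd z - ybar z) \<bullet> (ybar z - y))
      + Lf / 2 * (norm (xbar z - fst z))\<^sup>2 + Lg / 2 * (norm (ybar z - snd z))\<^sup>2"
    using 1 2 unfolding neg mult_minus_right inner_step_shift adjoint_inner gap_def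
    by (simp add: A.diff inner_diff_left inner_diff_right)
  then have "2 * gap (xbar z) (ybar z) x y \<le> (N (z - (x, y)))\<^sup>2 - (N (T z - (x, y)))\<^sup>2
      + ((2 * \<alpha>f - 1) * P z + (2 * \<alpha>g - 1) * Y z + S z)"
    using four_point_step[of z x y] smooth_terms[of z] by (simp add: algebra_simps)
  also have "(2 * \<alpha>f - 1) * P z + (2 * \<alpha>g - 1) * Y z + S z \<le> a2 * W z"
    unfolding W_def using nonneg S_le \<alpha>f_less \<alpha>g_less by (intro pdhg_a2_le) auto
  finally show ?thesis by simp
qed

text \<open>Each competitor is treated separately: the squares are recentred from it to
  \<open>s\<close>, convexity handles the segment, and the penalties absorb the linear terms. The
  bound does not depend on \<open>t\<close>.\<close>

lemma smoothed_gap_segment_le: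
  assumes c: "c \<in> saddle_points L" and t: "0 \<le> t" "t \<le> 1" and s: "s \<in> saddle_points L"
    and \<beta>: "0 < \<beta>x" "0 < \<beta>y"
  shows "smoothed_gap L \<tau> \<sigma> \<beta>x \<beta>y ((1 - t) *\<^sub>R c + t *\<^sub>R (xbar z, ybar z)) s
    \<le> ereal (1 / 2 * ((N (z - s))\<^sup>2 - (N (T z - s))\<^sup>2 + a2 * W z
        + real_of_ereal (1 / \<beta>x) * X z + real_of_ereal (1 / \<beta>y) * Y z))"
    (is "_ \<le> ereal (1 / 2 * (?\<Delta> + ?bx * X z + ?by * Y z))")
proof -
  obtain xc yc where cc: "c = (xc, yc)" by (cases c)
  obtain xs ys where ss: "s = (xs, ys)" by (cases s)
  define wx wy where "wx = (1 - t) *\<^sub>R xc + t *\<^sub>R xbar z" and "wy = (1 - t) *\<^sub>R yc + t *\<^sub>R ybar z"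
  have w: "(1 - t) *\<^sub>R c + t *\<^sub>R (xbar z, ybar z) = (wx, wy)" by (simp add: cc wx_def wy_def)
  have cfin: "f xc \<noteq> \<infinity>" "h yc \<noteq> \<infinity>" using c unfolding cc saddle_points_iff by auto
  have wfin: "f wx \<noteq> \<infinity>" "h wy \<noteq> \<infinity>"
    unfolding wx_def wy_def
    using convex_fun_finite[OF proper_f convex_f cfin(1) bar_finite(1) t]
      convex_fun_finite[OF proper_h convex_h cfin(2) bar_finite(2) t] by auto
  \<comment> \<open>As \<open>a2\<close> may be as small as -1, nonnegativity of the bracket takes
    the full decrease by \<open>W\<close> from \<open>fejer_step\<close>.\<close>
  have "- 1 * W z \<le> a2 * W z"
    using W_nonneg pdhg_a2_ge nonneg(1) \<alpha>f_less by (intro mult_right_mono) auto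
  then have \<Delta>: "0 \<le> ?\<Delta>" using fejer_step[OF s, of z] by linarith
  show ?thesis unfolding smoothed_gap_def w
  proof (rule SUP_least, clarsimp simp: ss)
    fix x y assume xy: "\<beta>x = \<infinity> \<longrightarrow> x = xs" "\<beta>y = \<infinity> \<longrightarrow> y = ys"
    obtain qx where qx: "\<beta>x * ereal ((norm (x - xs))\<^sup>2 / (2 * \<tau>)) = ereal qx"
      "2 * (t * (1 / \<tau> * ((fst (T z) - fst z) \<bullet> (x - xs)))) - 2 * qx \<le> ?bx * X z"
      using penalty_absorbs_linear[OF \<beta>(1) _ t \<tau>, of "x - xs" "fst (T z) - fst z"] xy by (auto simp: X_def)
    obtain qy where qy: "\<beta>y * ereal ((norm (y - ys))\<^sup>2 / (2 * \<sigma>)) = ereal qy"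
      "2 * (t * (1 / \<sigma> * ((ybar z - snd z) \<bullet> (y - ys)))) - 2 * qy \<le> ?by * Y z"
      using penalty_absorbs_linear[OF \<beta>(2) _ t \<sigma>, of "y - ys" "ybar z - snd z"] xy by (auto simp: Y_def)
    have "L wx y - L x wy - ereal qx - ereal qy \<le> ereal (1 / 2 * (?\<Delta> + ?bx * X z + ?by * Y z))"
    proof (cases "f x = \<infinity> \<or> h y = \<infinity>")
      case True
      \<comment> \<open>Finiteness at \<open>wx\<close> and \<open>wy\<close> rules out
        \<open>\<infinity> - \<infinity>\<close>, so competitors outside the domains do not affect
        the supremum.\<close>
      have "L wx y - L x wy = - \<infinity>"
        using True lagrangian_PInf[of x wy] lagrangian_MInf[OF wfin(1), of y]
          lagrangian_real[OF wfin(1), of y] lagrangian_real[OF _ wfin(2), of x]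
        by (cases "f x = \<infinity>"; cases "h y = \<infinity>") auto
      then show ?thesis by simp
    next
      case False
      then have fin: "f x \<noteq> \<infinity>" "h y \<noteq> \<infinity>" by auto
      define l where "l = 1 / \<tau> * ((fst (T z) - fst z) \<bullet> (x - xs)) + 1 / \<sigma> * ((ybar z - snd z) \<bullet> (y - ys))"
      have "(N (z - (x, y)))\<^sup>2 - (N (T z - (x, y)))\<^sup>2 = (N (z - s))\<^sup>2 - (N (T z - s))\<^sup>2 + 2 * l"
      proof -
        have "1 / \<tau> * (norm (fst z - x))\<^sup>2 - 1 / \<tau> * (norm (fst (T z) - x))\<^sup>2
          = 1 / \<tau> * (norm (fst z - xs))\<^sup>2 - 1 / \<tau> * (norm (fst (T z) - xs))\<^sup>2
            + 2 * (1 / \<tau> * ((fst (T z) - fst z) \<bullet> (x - xs)))"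
          using arg_cong[OF norm_sq_diff_shift[of "fst z" x "fst (T z)" xs], of "\<lambda>r. 1 / \<tau> * r"]
          by (simp only: right_diff_distrib distrib_left mult.left_commute)
        moreover have "1 / \<sigma> * (norm (snd z - y))\<^sup>2 - 1 / \<sigma> * (norm (ybar z - y))\<^sup>2
          = 1 / \<sigma> * (norm (snd z - ys))\<^sup>2 - 1 / \<sigma> * (norm (ybar z - ys))\<^sup>2
            + 2 * (1 / \<sigma> * ((ybar z - snd z) \<bullet> (y - ys)))"
          using arg_cong[OF norm_sq_diff_shift[of "snd z" y "ybar z" ys], of "\<lambda>r. 1 / \<sigma> * r"]
          by (simp only: right_diff_distrib distrib_left mult.left_commute)
        moreover have "snd (T z) = ybar z" by (simp add: T_eq)
        ultimately show ?thesis by (simp add: norm_V_power2[OF \<tau> \<sigma>] ss l_def)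
      qed
      with gap_step[OF fin, of z] have "2 * gap (xbar z) (ybar z) x y \<le> ?\<Delta> + 2 * l" by linarith
      moreover have "gap xc yc x y \<le> 0" using c fin unfolding cc saddle_points_iff by auto
      moreover have "gap wx wy x y \<le> (1 - t) * gap xc yc x y + t * gap (xbar z) (ybar z) x y"
        unfolding wx_def wy_def by (rule gap_convex[OF cfin bar_finite t])
      moreover have "2 * (t * l) - 2 * qx - 2 * qy \<le> ?bx * X z + ?by * Y z"
        using qx(2) qy(2) unfolding l_def distrib_left by linarith
      ultimately have "2 * (gap wx wy x y - qx - qy) \<le> ?\<Delta> + (?bx * X z + ?by * Y z)"
        using \<Delta> t by (intro convex_combination_gap_bound)
      moreover have "L wx y - L x wy = ereal (gap wx wy x y)"
        using lagrangian_real[OF wfin(1) fin(2)] lagrangian_real[OF fin(1) wfin(2)] by (simp add: gap_def)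
      ultimately show ?thesis by (simp add: ss)
    qed
    then show "L wx y - L x wy - \<beta>x * ereal ((norm (x - xs))\<^sup>2 / (2 * \<tau>))
        - \<beta>y * ereal ((norm (y - ys))\<^sup>2 / (2 * \<sigma>))
      \<le> ereal (((N (z - (xs, ys)))\<^sup>2 - (N (T z - (xs, ys)))\<^sup>2 + a2 * W z + ?bx * X z + ?by * Y z) / 2)"
      unfolding qx(1) qy(1) by (simp add: ss)
  qed
qed

text \<open>The ball hypothesis concerns the successor \<open>T z\<close>, because it is
  \<open>T z\<close> that is compared with the projected point \<open>w\<close>.\<close>

lemma contraction_step:
  defines "Zs \<equiv> saddle_points L"
  assumes c: "c \<in> Zs" and z: "N (T z - c) \<le> r" and ball: "{w. N (w - c) \<le> r} \<subseteq> R"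
    and \<beta>: "0 < \<beta>x" "0 < \<beta>y" and \<eta>: "0 < \<eta>"
    and growth: "\<And>s w. s \<in> Zs \<Longrightarrow> w \<in> R \<Longrightarrow>
      ereal (\<eta> / 2 * (dist_V \<tau> \<sigma> w Zs)\<^sup>2) \<le> smoothed_gap L \<tau> \<sigma> \<beta>x \<beta>y w s"
    and \<Lambda>: "\<Lambda> = lam / max ((1 + a2) * lam + real_of_ereal (1 / \<beta>x)) ((2 + a2) * lam + real_of_ereal (1 / \<beta>y))"
  shows "(1 + \<Lambda> * (\<eta> / (1 + \<eta> / lam))) * (dist_V \<tau> \<sigma> (T z) Zs)\<^sup>2 \<le> (dist_V \<tau> \<sigma> z Zs)\<^sup>2"
proof -
  have Zs: "closed Zs" "convex Zs" "Zs \<noteq> {}"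
    using closed_saddle_points convex_saddle_points c by (auto simp: Zs_def)
  define s where "s = proj_V \<tau> \<sigma> Zs z"
  have s: "s \<in> Zs" and ds: "N (z - s) = dist_V \<tau> \<sigma> z Zs"
    using proj_V[OF Zs \<tau> \<sigma>] by (auto simp: s_def)
  define bx by' where "bx = real_of_ereal (1 / \<beta>x)" and "by' = real_of_ereal (1 / \<beta>y)"
  have b: "0 \<le> bx" "0 \<le> by'"
    using \<beta> by (auto simp: bx_def by'_def intro!: real_of_ereal_pos)
  obtain t where t: "0 \<le> t" "t \<le> 1"
    and "N ((1 - t) *\<^sub>R c + t *\<^sub>R (xbar z, ybar z) - c) \<le> r"
    and "N (T z - ((1 - t) *\<^sub>R c + t *\<^sub>R (xbar z, ybar z))) \<le> N (T z - (xbar z, ybar z))"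
    using norm_V_ball_projection_step[OF \<tau> \<sigma> z, of "(xbar z, ybar z)"] by blast
  then obtain w where w: "w = (1 - t) *\<^sub>R c + t *\<^sub>R (xbar z, ybar z)" and wR: "w \<in> R"
    and wn: "N (T z - w) \<le> N (T z - (xbar z, ybar z))" using ball by blast
  define \<Delta> where "\<Delta> = (N (z - s))\<^sup>2 - (N (T z - s))\<^sup>2"
  have W\<Delta>: "W z \<le> \<Delta>" using fejer_step[of s z] s by (simp add: Zs_def \<Delta>_def)
  have "ereal (\<eta> / 2 * (dist_V \<tau> \<sigma> w Zs)\<^sup>2) \<le> ereal (1 / 2 * (\<Delta> + a2 * W z + bx * X z + by' * Y z))"
    using order_trans[OF growth[OF s wR] smoothed_gap_segment_le[OF c[unfolded Zs_def] t s[unfolded Zs_def] \<beta>, of z, folded w]]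
    by (simp add: \<Delta>_def bx_def by'_def)
  then have 1: "\<eta> * (dist_V \<tau> \<sigma> w Zs)\<^sup>2 \<le> \<Delta> + a2 * W z + bx * X z + by' * Y z" by simp
  \<comment> \<open>Only the primal correction separates the two points, and
    \<open>\<gamma> < 1\<close> bounds its square by \<open>Y z\<close>. The resulting
    \<open>lam * Y z\<close> turns \<open>1 + a2\<close> into \<open>2 + a2\<close> in the second
    entry of the rate.\<close>
  have "(N (T z - (xbar z, ybar z)))\<^sup>2 = S z"
    using \<tau> by (simp add: norm_V_power2[OF \<tau> \<sigma>] T_eq S_def power_mult_distrib)
      (simp add: power2_eq_square)
  then have "(N (T z - w))\<^sup>2 \<le> S z"
    using power_mono[OF wn norm_V_nonneg[OF \<tau> \<sigma>], of 2] by simp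
  also have "\<dots> \<le> 1 * Y z"
    using S_le[of z] mult_right_mono[of \<gamma> 1 "Y z"] nonneg(4)[of z] \<gamma>_less by linarith
  finally have 2: "lam * (N (T z - w))\<^sup>2 \<le> lam * Y z" using lam_pos by simp
  define K where "K = \<eta> / (1 + \<eta> / lam)"
  have K: "0 \<le> K" using \<eta> lam_pos by (simp add: K_def)
  define d where "d = dist_V \<tau> \<sigma> (T z) Zs"
  \<comment> \<open>The triangle inequality through \<open>w\<close>, with weight
    \<open>\<eta>\<close> from the growth condition and \<open>lam\<close> for the displacement, is
    the origin of \<open>\<eta> / (1 + \<eta> / lam)\<close>.\<close>
  have "K * d\<^sup>2 \<le> \<eta> * (dist_V \<tau> \<sigma> w Zs)\<^sup>2 + lam * (N (T z - w))\<^sup>2"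
    unfolding K_def d_def using Zs(3) \<tau> \<sigma> \<eta> lam_pos
    by (intro weighted_square_sum dist_V_nonneg dist_V_triangle)
  then have "K * d\<^sup>2 \<le> \<Delta> + a2 * W z + bx * X z + (by' + lam) * Y z"
    using 1 2 by (simp add: distrib_right)
  then have "lam * (K * d\<^sup>2) \<le> lam * (\<Delta> + a2 * W z + bx * X z + (by' + lam) * Y z)"
    using lam_pos by simp
  also have "\<dots> \<le> max ((1 + a2) * lam + bx) ((2 + a2) * lam + by') * \<Delta>"
    using lam_pos pdhg_a2_ge[OF nonneg(1) \<alpha>f_less] b nonneg(3,4) W\<Delta> lam_le
    by (intro rate_bound) auto
  finally have 3: "lam * (K * d\<^sup>2) \<le> max ((1 + a2) * lam + bx) ((2 + a2) * lam + by') * \<Delta>" .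
  have "0 < 1 * lam" using lam_pos by simp
  also have "\<dots> \<le> (2 + a2) * lam"
    using lam_pos pdhg_a2_ge[OF nonneg(1) \<alpha>f_less, of \<alpha>g \<gamma>] by (intro mult_right_mono) auto
  finally have "0 < max ((1 + a2) * lam + bx) ((2 + a2) * lam + by')" using b by linarith
  then have "\<Lambda> * (K * d\<^sup>2) \<le> \<Delta>"
    using 3 unfolding \<Lambda> bx_def[symmetric] by'_def[symmetric] by (simp add: pos_divide_le_eq mult.commute)
  \<comment> \<open>The projection \<open>s\<close> of \<open>z\<close> need not be that of
    \<open>T z\<close>, but any saddle point bounds the distance, so \<open>\<Delta>\<close> is at
    most the decrease of the squared distances.\<close>
  moreover have "d\<^sup>2 \<le> (N (T z - s))\<^sup>2"
    unfolding d_def using s \<tau> \<sigma> Zs(3) by (intro power_mono dist_V_le dist_V_nonneg)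
  ultimately show ?thesis
    unfolding K_def[symmetric] d_def[symmetric] ds[symmetric] \<Delta>_def by (simp add: algebra_simps)
qed

end

theorem theorem1:
  fixes A :: "'a::{real_inner, complete_space} \<Rightarrow> 'b::{real_inner, complete_space}"
    and f f2 :: "'a \<Rightarrow> ereal" and g g2 :: "'b \<Rightarrow> ereal"
    and Lf Lg \<tau> \<sigma> \<gamma> \<alpha>f \<alpha>g lam a2 \<eta> \<Lambda> :: real
    and \<beta>x \<beta>y :: ereal
    and R Zs :: "('a \<times> 'b) set" and z0 :: "'a \<times> 'b"
  assumes "bounded_linear A"
    and "proper_lsc_convex f" and "proper_lsc_convex f2"
    and "proper_lsc_convex g" and "proper_lsc_convex g2"
    and "lipschitz_smooth Lf f2" and "lipschitz_smooth Lg (conjugate g2)"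
    and "Zs = saddle_points (lagrangian A f f2 g g2)" and "Zs \<noteq> {}"
    and "\<tau> > 0" and "\<sigma> > 0"
    and "\<gamma> = \<sigma> * \<tau> * (onorm A)\<^sup>2" and "\<alpha>f = \<tau> * Lf / 2" and "\<alpha>g = \<sigma> * Lg / 2"
    and "\<gamma> < 1" and "\<alpha>f < 1" and "\<alpha>g + \<gamma> < 1"
    and "lam = 1 - \<alpha>f - (\<alpha>g - (1 - \<gamma>) * \<alpha>f) / 2
               - sqrt ((1 - \<alpha>f)\<^sup>2 * \<gamma> + ((1 - \<gamma>) * \<alpha>f - \<alpha>g)\<^sup>2 / 4)"
    and "a2 = max ((2 * \<alpha>f - 1) / (1 - \<alpha>f)) ((2 * \<alpha>g - 1 + \<gamma>) / (1 - \<alpha>g - \<gamma>))"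
    and "\<beta>x > 0" and "\<beta>y > 0" and "\<eta> > 0"
    and "\<And>zs z. zs \<in> Zs \<Longrightarrow> z \<in> R \<Longrightarrow>
           smoothed_gap (lagrangian A f f2 g g2) \<tau> \<sigma> \<beta>x \<beta>y z zs
             \<ge> ereal (\<eta> / 2 * (dist_V \<tau> \<sigma> z Zs)\<^sup>2)"
    and "{z. norm_V \<tau> \<sigma> (z - proj_V \<tau> \<sigma> Zs z0) \<le> dist_V \<tau> \<sigma> z0 Zs} \<subseteq> R"
    and "\<Lambda> = lam / max ((1 + a2) * lam + real_of_ereal (1 / \<beta>x))
                         ((2 + a2) * lam + real_of_ereal (1 / \<beta>y))"
  shows "\<forall>k. (1 + \<Lambda> * (\<eta> / (1 + \<eta> / lam)))
               * (dist_V \<tau> \<sigma> (pdhg A f f2 g g2 \<tau> \<sigma> z0 (Suc k)) Zs)\<^sup>2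
             \<le> (dist_V \<tau> \<sigma> (pdhg A f f2 g g2 \<tau> \<sigma> z0 k) Zs)\<^sup>2"
proof
  fix k
  have plc: "proper_lsc_convex (conjugate g)" by (rule proper_lsc_convex_conjugate) fact
  have cv: "convex_fun f2" "convex_fun (conjugate g2)"
    using assms(3,5) by (auto simp: proper_lsc_convex_def intro: convex_fun_conjugate)
  interpret pdhg_problem A f f2 g g2 Lf Lg \<tau> \<sigma> \<gamma> \<alpha>f \<alpha>g
    by (intro pdhg_problem.intro saddle_problem.intro pdhg_problem_axioms.intro) (fact assms plc cv)+
  have Zs: "closed Zs" "convex Zs" "Zs \<noteq> {}"
    using closed_saddle_points convex_saddle_points assms(9) by (simp_all add: assms(8))
  define c where "c = proj_V \<tau> \<sigma> Zs z0"
  have c: "c \<in> Zs" and r: "N (z0 - c) = dist_V \<tau> \<sigma> z0 Zs"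
    using proj_V[OF Zs \<tau> \<sigma>] by (auto simp: c_def)
  define z where "z = pdhg A f f2 g g2 \<tau> \<sigma> z0"
  have z_Suc: "z (Suc j) = T (z j)" for j by (simp add: z_def pdhg_def)
  \<comment> \<open>Decrease of the distance to the single saddle point \<open>c\<close> keeps all
    iterates in the initial ball, which lies in \<open>R\<close>.\<close>
  have mono: "N (z j - c) \<le> dist_V \<tau> \<sigma> z0 Zs" for j
  proof (induction j)
    case 0
    then show ?case using r by (simp add: z_def pdhg_def)
  next
    case (Suc j)
    have "(N (z (Suc j) - c))\<^sup>2 \<le> (N (z j - c))\<^sup>2"
      using fejer_step[of c "z j"] W_nonneg[of "z j"] c assms(8) by (simp add: z_Suc)
    then have "N (z (Suc j) - c) \<le> N (z j - c)"
      by (rule power2_le_imp_le) (rule norm_V_nonneg[OF \<tau> \<sigma>])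
    then show ?case using Suc.IH by linarith
  qed
  have lam: "lam = pdhg_lam \<alpha>f \<alpha>g \<gamma>" and a2: "a2 = pdhg_a2 \<alpha>f \<alpha>g \<gamma>"
    unfolding pdhg_lam_def pdhg_a2_def by (fact assms(18) assms(19))+
  have "(1 + \<Lambda> * (\<eta> / (1 + \<eta> / lam))) * (dist_V \<tau> \<sigma> (T (z k)) Zs)\<^sup>2 \<le> (dist_V \<tau> \<sigma> (z k) Zs)\<^sup>2"
    unfolding assms(8) lam
    by (rule contraction_step[OF c[unfolded assms(8)] mono[of "Suc k", unfolded z_Suc assms(8)]
          assms(24)[folded c_def, unfolded assms(8)] assms(20-22) assms(23)[unfolded assms(8)]
          assms(25)[unfolded lam a2]])
  then show "(1 + \<Lambda> * (\<eta> / (1 + \<eta> / lam))) * (dist_V \<tau> \<sigma> (pdhg A f f2 g g2 \<tau> \<sigma> z0 (Suc k)) Zs)\<^sup>2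
      \<le> (dist_V \<tau> \<sigma> (pdhg A f f2 g g2 \<tau> \<sigma> z0 k) Zs)\<^sup>2"
    by (simp only: z_Suc[unfolded z_def] z_def)
qed

end
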